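(* Fix an integer $q\ge 2$. For any $\epsilon > 0$, the following holds for any sufficiently large $n$ and any $m$ less than or equal to the number of edges of the Turán graph $T_q(n)$. (i) Every $n$-vertex graph with $m$ edges has fewer than $e^{(\mathrm{OPT}(m/n^2) + \epsilon) n}$ proper $q$-colorings. (ii) Any ${\boldsymbol\alpha}$ which solves $\mathrm{OPT}(m/n^2)$ yields a graph $G_{\boldsymbol\alpha}'(n)$ (via Construction 2) which has at least $m$ edges and more than $e^{(\mathrm{OPT}(m/n^2) - \epsilon) n}$ proper $q$-colorings.
   Context: Logarithms are natural. Optimization Problem 1: vectors ${\boldsymbol\alpha}$ have real coordinates $\alpha_A$ indexed by the $2^q-1$ nonempty subsets $A\subseteq[q]$. Define $\mathrm{OBJ}({\boldsymbol\alpha}) = \sum_A \alpha_A\log|A|$, $\mathrm{V}({\boldsymbol\alpha})=\sum_A\alpha_A$, $\mathrm{E}({\boldsymbol\alpha}) = \sum_{\{A,B\}:A\cap B=\emptyset}\alpha_A\alpha_B$ (unordered pairs of disjoint nonempty sets). For real $\gamma$, $\mathrm{FEAS}(\gamma)$ is the set of ${\boldsymbol\alpha}$ with ${\boldsymbol\alpha}\ge 0$, $\mathrm{V}({\boldsymbol\alpha})=1$, $\mathrm{E}({\boldsymbol\alpha})\ge\gamma$; $\mathrm{OPT}(\gamma)$ is the maximum of $\mathrm{OBJ}$ over $\mathrm{FEAS}(\gamma)$; ${\boldsymbol\alpha}$ solves $\mathrm{OPT}(\gamma)$ if ${\boldsymbol\alpha}\in\mathrm{FEAS}(\gamma)$ and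 $\mathrm{OBJ}({\boldsymbol\alpha})=\mathrm{OPT}(\gamma)$. Construction 1 ($G_{\boldsymbol\alpha}(n)$): partition $n$ vertices into clusters $V_A$ (nonempty $A\subseteq[q]$) with $|n\alpha_A - |V_A|| < 1$, and join $V_A$ completely to $V_B$ whenever $A\cap B=\emptyset$; no other edges. Construction 2 ($G'_{\boldsymbol\alpha}(n)$, for ${\boldsymbol\alpha}\in\mathrm{FEAS}(m/n^2)$): if $G_{\boldsymbol\alpha}(n)$ has at least $m$ edges, let $G'_{\boldsymbol\alpha}(n)=G_{\boldsymbol\alpha}(n)$. Otherwise it is short by $k$ edges; let $V_A$ be its largest cluster with $|A|\ge 2$. If $|V_A|\ge 2\lceil\sqrt k\rceil$, choose disjoint $U_1,U_2\subseteq V_A$ of size $\lceil\sqrt k\rceil$ and add a bipartite graph with $k$ edges between them; call the result $G'_{\boldsymbol\alpha}(n)$. If $|V_A|<2\lceil\sqrt k\rceil$, let $G'_{\boldsymbol\alpha}(n)=T_q(n)$. $T_q(n)$ is the complete $q$-partite graph on $n$ vertices with parts of sizes $\lfloor n/q\rfloor$ or $\lceil n/q\rceil$. *)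

theory Defs
  imports Complex_Main "HOL-Library.FuncSet" "HOL-Library.Disjoint_Sets"
begin

section \<open>Graphs, colorings, Turan graphs\<close>

text \<open>A finite simple graph is a finite vertex set together with a set of two-element subsets.\<close>

definition simple_graph :: "'v set \<Rightarrow> 'v set set \<Rightarrow> bool" where
  "simple_graph V E \<longleftrightarrow> finite V \<and> E \<subseteq> {{u, v} | u v. u \<in> V \<and> v \<in> V \<and> u \<noteq> v}"

definition proper_colorings :: "nat \<Rightarrow> 'v set \<Rightarrow> 'v set set \<Rightarrow> ('v \<Rightarrow> nat) set" where
  "proper_colorings q V E = {c \<in> V \<rightarrow>\<^sub>E {1..q}. \<forall>u v. {u, v} \<in> E \<longrightarrow> c u \<noteq> c v}"

text \<open>\<open>turan_graph q V E\<close>: \<open>(V, E)\<close> is a copy of \<open>T\<^sub>q(n)\<close>, \<open>n = card V\<close>; the map \<open>part\<close> sends each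
  vertex to its part. The part sizes make such a graph unique up to isomorphism.\<close>

definition turan_graph :: "nat \<Rightarrow> 'v set \<Rightarrow> 'v set set \<Rightarrow> bool" where
  "turan_graph q V E \<longleftrightarrow> finite V \<and>
     (\<exists>part \<in> V \<rightarrow> {1..q}.
        (\<forall>i\<in>{1..q}. int (card {v \<in> V. part v = i})
            \<in> {\<lfloor>real (card V) / real q\<rfloor>, \<lceil>real (card V) / real q\<rceil>}) \<and>
        E = {{u, v} | u v. u \<in> V \<and> v \<in> V \<and> part u \<noteq> part v})"


section \<open>The optimization problem\<close>

text \<open>Vectors are functions \<open>nat set \<Rightarrow> real\<close>; only their values on \<open>color_sets q\<close> are ever used.\<close>

definition color_sets :: "nat \<Rightarrow> nat set set" where
  "color_sets q = {A. A \<subseteq> {1..q} \<and> A \<noteq> {}}"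

definition obj :: "nat \<Rightarrow> (nat set \<Rightarrow> real) \<Rightarrow> real" where
  "obj q \<alpha> = (\<Sum>A\<in>color_sets q. \<alpha> A * ln (real (card A)))"

definition vtotal :: "nat \<Rightarrow> (nat set \<Rightarrow> real) \<Rightarrow> real" where
  "vtotal q \<alpha> = (\<Sum>A\<in>color_sets q. \<alpha> A)"

text \<open>The sum ranges over unordered pairs \<open>P = {A, B}\<close>. As \<open>A\<close> and \<open>B\<close> are disjoint and nonempty,
  they are distinct, so the product over \<open>P\<close> is \<open>\<alpha> A * \<alpha> B\<close>.\<close>

definition etotal :: "nat \<Rightarrow> (nat set \<Rightarrow> real) \<Rightarrow> real" where
  "etotal q \<alpha> =
     (\<Sum>P \<in> {{A, B} | A B. A \<in> color_sets q \<and> B \<in> color_sets q \<and> A \<inter> B = {}}. \<Prod>A\<in>P. \<alpha> A)"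

definition feas :: "nat \<Rightarrow> real \<Rightarrow> (nat set \<Rightarrow> real) set" where
  "feas q \<gamma> = {\<alpha>. (\<forall>A\<in>color_sets q. 0 \<le> \<alpha> A) \<and> vtotal q \<alpha> = 1 \<and> etotal q \<alpha> \<ge> \<gamma>}"

definition opt :: "nat \<Rightarrow> real \<Rightarrow> real" where
  "opt q \<gamma> = (GREATEST x. x \<in> obj q ` feas q \<gamma>)"

definition solves_opt :: "nat \<Rightarrow> real \<Rightarrow> (nat set \<Rightarrow> real) \<Rightarrow> bool" where
  "solves_opt q \<gamma> \<alpha> \<longleftrightarrow> \<alpha> \<in> feas q \<gamma> \<and> obj q \<alpha> = opt q \<gamma>"


section \<open>The constructions\<close>

text \<open>Both constructions involve choices (rounding of cluster sizes, assignment of vertices, ties,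
  placement of the extra edges), so they are relations between the input and any possible outcome.
  Clusters may be empty.\<close>

definition clusters :: "nat \<Rightarrow> (nat set \<Rightarrow> real) \<Rightarrow> 'v set \<Rightarrow> (nat set \<Rightarrow> 'v set) \<Rightarrow> bool" where
  "clusters q \<alpha> V C \<longleftrightarrow>
     (\<Union>A\<in>color_sets q. C A) = V \<and> disjoint_family_on C (color_sets q) \<and>
     (\<forall>A\<in>color_sets q. \<bar>real (card V) * \<alpha> A - real (card (C A))\<bar> < 1)"

definition cluster_edges :: "nat \<Rightarrow> (nat set \<Rightarrow> 'v set) \<Rightarrow> 'v set set" where
  "cluster_edges q C =
     {{u, v} | u v A B. A \<in> color_sets q \<and> B \<in> color_sets q \<and> A \<inter> B = {} \<and> u \<in> C A \<and> v \<in> C B}"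

text \<open>\<open>construction1 q \<alpha> V C E\<close>: \<open>(V, E)\<close> is a possible \<open>G\<^sub>\<alpha>(n)\<close>, \<open>n = card V\<close>, with clusters \<open>C\<close>.\<close>

definition construction1 ::
    "nat \<Rightarrow> (nat set \<Rightarrow> real) \<Rightarrow> 'v set \<Rightarrow> (nat set \<Rightarrow> 'v set) \<Rightarrow> 'v set set \<Rightarrow> bool" where
  "construction1 q \<alpha> V C E \<longleftrightarrow> finite V \<and> clusters q \<alpha> V C \<and> E = cluster_edges q C"

definition largest_cluster :: "nat \<Rightarrow> (nat set \<Rightarrow> 'v set) \<Rightarrow> nat set \<Rightarrow> bool" where
  "largest_cluster q C A \<longleftrightarrow> A \<in> color_sets q \<and> card A \<ge> 2 \<and>
     (\<forall>B\<in>color_sets q. card B \<ge> 2 \<longrightarrow> card (C B) \<le> card (C A))"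

text \<open>\<open>construction2 q \<alpha> m V E'\<close>: \<open>(V, E')\<close> is a possible \<open>G'\<^sub>\<alpha>(n)\<close>, \<open>n = card V\<close>, for edge target
  \<open>m\<close>; here \<open>k\<close> is the number of missing edges and \<open>s\<close> its rounded-up square root.\<close>

definition construction2 ::
    "nat \<Rightarrow> (nat set \<Rightarrow> real) \<Rightarrow> nat \<Rightarrow> 'v set \<Rightarrow> 'v set set \<Rightarrow> bool" where
  "construction2 q \<alpha> m V E' \<longleftrightarrow>
     (\<exists>C E. construction1 q \<alpha> V C E \<and>
        (if card E \<ge> m then E' = E
         else (\<exists>A. largest_cluster q C A \<and>
           (let k = m - card E; s = nat \<lceil>sqrt (real k)\<rceil> in
             if card (C A) \<ge> 2 * s
             then (\<exists>U1 U2 F. U1 \<subseteq> C A \<and> U2 \<subseteq> C A \<and> U1 \<inter> U2 = {} \<and> card U1 = s \<and> card U2 = s \<and>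
                     F \<subseteq> {{u, v} | u v. u \<in> U1 \<and> v \<in> U2} \<and> card F = k \<and> E' = E \<union> F)
             else turan_graph q V E'))))"

end

theory Submission
  imports Defs "HOL-Analysis.Function_Topology" "HOL-Real_Asymp.Real_Asymp"
begin

text \<open>
  An independent set \<open>I\<close> of a graph with \<open>n\<close> vertices has a fingerprint \<open>S \<subseteq> I\<close> of bounded size that
  determines a superset of \<open>I\<close> spanning at most \<open>\<delta> n\<^sup>2\<close> edges. Applied to all color classes, this covers
  the proper colorings by polynomially many product sets \<open>\<Prod>v. f v\<close>, where \<open>f\<close> maps vertices to color
  sets and all but \<open>q \<delta> n\<^sup>2\<close> edges join vertices with disjoint color sets. The frequencies of the
  values of \<open>f\<close> are then feasible for \<open>m / n\<^sup>2 - O(\<delta>)\<close>, and their objective value is the logarithm of the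
  size of the product set divided by \<open>n\<close>. Relaxing the edge constraint slightly raises the optimum
  only slightly, which gives (i) without a regularity lemma.

  For (ii), rounding loses \<open>O(n)\<close> edges, so repairing the graph constrains only \<open>O(\<surd>n)\<close> vertices. If the
  largest cluster is too small for the repair, the optimum is so close to \<open>0\<close> that a single coloring
  of the Turan graph suffices.
\<close>

section \<open>Set-valued vertex maps\<close>

text \<open>Every unordered pair in the image has exactly two preimages in \<open>R\<close>:
  symmetry supplies both orders and irreflexivity makes them distinct. Edge counts and
  \<open>etotal\<close> can thus be treated as sums over ordered pairs, which split into products of
  fibers.\<close>

lemma sum_ordered_pairs:
  fixes g :: "'a set \<Rightarrow> real"
  assumes "finite R" "sym R" "irrefl R"
  shows "(\<Sum>(x, y)\<in>R. g {x, y}) = 2 * (\<Sum>P\<in>(\<lambda>(x, y). {x, y}) ` R. g P)"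
proof -
  let ?h = "\<lambda>(x, y). {x, y}"
  have fiber: "(\<Sum>p\<in>{p \<in> R. ?h p = P}. case p of (x, y) \<Rightarrow> g {x, y}) = 2 * g P"
    if "P \<in> ?h ` R" for P
  proof -
    obtain x y where xy: "(x, y) \<in> R" "P = {x, y}" using \<open>P \<in> _\<close> by auto
    have "{p \<in> R. ?h p = P} = {(x, y), (y, x)}"
      using xy assms(2) by (auto simp: doubleton_eq_iff dest: symD)
    moreover have "x \<noteq> y" using xy assms(3) by (auto simp: irrefl_def)
    ultimately show ?thesis using xy by (simp add: insert_commute)
  qed
  have "(\<Sum>(x, y)\<in>R. g {x, y}) = (\<Sum>P\<in>?h ` R. \<Sum>p\<in>{p \<in> R. ?h p = P}. case p of (x, y) \<Rightarrow> g {x, y})"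
    by (rule sum.image_gen[OF assms(1)])
  also have "\<dots> = (\<Sum>P\<in>?h ` R. 2 * g P)"
    by (rule sum.cong[OF refl fiber])
  finally show ?thesis by (simp add: sum_distrib_left)
qed

lemma card_ordered_pairs:
  assumes "finite R" "sym R" "irrefl R"
  shows "card R = 2 * card ((\<lambda>(x, y). {x, y}) ` R)"
proof -
  have "real (card R) = 2 * real (card ((\<lambda>(x, y). {x, y}) ` R))"
    using sum_ordered_pairs[OF assms, of "\<lambda>_. 1"] by (simp add: case_prod_unfold)
  then show ?thesis by linarith
qed

section \<open>Color sets and their disjoint pairs\<close>

lemma finite_color_sets [simp]: "finite (color_sets q)"
  by (rule finite_subset[of _ "Pow {1..q}"]) (auto simp: color_sets_def)

lemma finite_in_color_sets: "A \<in> color_sets q \<Longrightarrow> finite A"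
  by (auto simp: color_sets_def intro: finite_subset)

lemma color_sets_card_pos: "A \<in> color_sets q \<Longrightarrow> card A \<ge> 1"
  using finite_in_color_sets[of A q] by (auto simp: color_sets_def Suc_le_eq card_gt_0_iff)

lemma color_sets_card_le: "A \<in> color_sets q \<Longrightarrow> card A \<le> q"
  using card_mono[of "{1..q}" A] by (simp add: color_sets_def)

lemma ln_card_bounds:
  assumes "A \<in> color_sets q"
  shows "0 \<le> ln (real (card A))" "ln (real (card A)) \<le> ln (real q)"
  using color_sets_card_pos[OF assms] color_sets_card_le[OF assms] by auto

definition disjoint_color_pairs :: "nat \<Rightarrow> (nat set \<times> nat set) set" where
  "disjoint_color_pairs q = {(A, B). A \<in> color_sets q \<and> B \<in> color_sets q \<and> A \<inter> B = {}}"

lemma disjoint_color_pairs_subset: "disjoint_color_pairs q \<subseteq> color_sets q \<times> color_sets q"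
  by (auto simp: disjoint_color_pairs_def)

lemma finite_disjoint_color_pairs [simp]: "finite (disjoint_color_pairs q)"
  by (rule finite_subset[OF disjoint_color_pairs_subset]) simp

text \<open>Color sets are nonempty, so disjointness is irreflexive on them: no pair collapses to a
  singleton, and \<open>etotal\<close> becomes half of a quadratic form.\<close>

lemma etotal_ordered: "2 * etotal q \<alpha> = (\<Sum>(A, B)\<in>disjoint_color_pairs q. \<alpha> A * \<alpha> B)"
proof -
  let ?R = "disjoint_color_pairs q"
  have irr: "irrefl ?R"
    by (auto simp: irrefl_def disjoint_color_pairs_def color_sets_def)
  have "{{A, B} | A B. A \<in> color_sets q \<and> B \<in> color_sets q \<and> A \<inter> B = {}} = (\<lambda>(A, B). {A, B}) ` ?R"
    by (auto simp: disjoint_color_pairs_def)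
  moreover have "(\<Sum>(A, B)\<in>?R. \<Prod>X\<in>{A, B}. \<alpha> X) = 2 * (\<Sum>P\<in>(\<lambda>(A, B). {A, B}) ` ?R. \<Prod>X\<in>P. \<alpha> X)"
    by (rule sum_ordered_pairs[OF finite_disjoint_color_pairs _ irr])
      (auto simp: disjoint_color_pairs_def sym_def)
  moreover have "(\<Sum>(A, B)\<in>?R. \<Prod>X\<in>{A, B}. \<alpha> X) = (\<Sum>(A, B)\<in>?R. \<alpha> A * \<alpha> B)"
  proof (intro sum.cong refl, clarify)
    fix A B assume "(A, B) \<in> ?R"
    then have "A \<noteq> B" using irr by (auto simp: irrefl_def)
    then show "(\<Prod>X\<in>{A, B}. \<alpha> X) = \<alpha> A * \<alpha> B" by simp
  qed
  ultimately show ?thesis by (simp add: etotal_def)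
qed

text \<open>This vector links vertex maps to the optimization problem: for a map into the color sets
  on a finite nonempty \<open>V\<close> it has mass 1, its \<open>obj\<close> is the logarithm of
  the size of \<open>PiE V f\<close> divided by \<open>card V\<close>, and its \<open>etotal\<close>
  is the number of \<open>disjoint_edges\<close> divided by the square of
  \<open>card V\<close>.\<close>

definition weight :: "'v set \<Rightarrow> ('v \<Rightarrow> nat set) \<Rightarrow> nat set \<Rightarrow> real" where
  "weight V f A = real (card {v \<in> V. f v = A}) / real (card V)"

definition disjoint_edges :: "'v set \<Rightarrow> ('v \<Rightarrow> nat set) \<Rightarrow> 'v set set" where
  "disjoint_edges V f = {{u, v} | u v. u \<in> V \<and> v \<in> V \<and> f u \<inter> f v = {}}"

lemma weight_nonneg: "0 \<le> weight V f A"
  by (simp add: weight_def)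

lemma sum_over_fibers:
  fixes g :: "nat set \<Rightarrow> real"
  assumes "finite V" "f \<in> V \<rightarrow> color_sets q"
  shows "(\<Sum>A\<in>color_sets q. real (card {v \<in> V. f v = A}) * g A) = (\<Sum>v\<in>V. g (f v))"
proof -
  have "(\<Sum>v\<in>V. g (f v)) = (\<Sum>A\<in>color_sets q. \<Sum>v\<in>{v \<in> V. f v = A}. g (f v))"
    using assms by (intro sum.group[symmetric]) auto
  also have "\<dots> = (\<Sum>A\<in>color_sets q. real (card {v \<in> V. f v = A}) * g A)"
    by (intro sum.cong) auto
  finally show ?thesis by simp
qed

lemma weight_vtotal:
  assumes "finite V" "V \<noteq> {}" "f \<in> V \<rightarrow> color_sets q"
  shows "vtotal q (weight V f) = 1"
proof -
  have "vtotal q (weight V f) = (\<Sum>A\<in>color_sets q. real (card {v \<in> V. f v = A}) * 1) / card V"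
    by (simp add: vtotal_def weight_def sum_divide_distrib)
  then show ?thesis
    using sum_over_fibers[OF assms(1,3), of "\<lambda>_. 1"] assms by (simp add: card_gt_0_iff)
qed

lemma weight_obj:
  assumes "finite V" "V \<noteq> {}" "f \<in> V \<rightarrow> color_sets q"
  shows "real (card V) * obj q (weight V f) = (\<Sum>v\<in>V. ln (real (card (f v))))"
proof -
  have "real (card V) \<noteq> 0" using assms by simp
  then have "real (card V) * obj q (weight V f)
      = (\<Sum>A\<in>color_sets q. real (card {v \<in> V. f v = A}) * ln (real (card A)))"
    unfolding obj_def weight_def sum_distrib_left by (intro sum.cong) auto
  then show ?thesis using sum_over_fibers[OF assms(1,3), of "\<lambda>A. ln (real (card A))"] by simp
qed

text \<open>Group the vertex pairs by the pair of their color sets: over a disjoint pair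
  \<open>(A, B)\<close> lies the product of the two fibers.\<close>

lemma weight_etotal:
  assumes "finite V" "V \<noteq> {}" "f \<in> V \<rightarrow> color_sets q"
  shows "2 * (real (card V))\<^sup>2 * etotal q (weight V f)
    = real (card {(u, v). u \<in> V \<and> v \<in> V \<and> f u \<inter> f v = {}})"
proof -
  let ?n = "real (card V)" and ?F = "\<lambda>A. {v \<in> V. f v = A}"
  let ?R = "{(u, v). u \<in> V \<and> v \<in> V \<and> f u \<inter> f v = {}}"
  have n0: "?n \<noteq> 0" using assms by simp
  have finR: "finite ?R"
    by (rule finite_subset[of _ "V \<times> V"]) (use assms in auto)
  have "2 * ?n\<^sup>2 * etotal q (weight V f) = ?n\<^sup>2 * (\<Sum>(A, B)\<in>disjoint_color_pairs q. weight V f A * weight V f B)"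
    by (simp flip: etotal_ordered)
  also have "\<dots> = (\<Sum>(A, B)\<in>disjoint_color_pairs q. real (card (?F A)) * real (card (?F B)))"
    unfolding sum_distrib_left weight_def using n0 by (intro sum.cong) (auto simp: power2_eq_square)
  also have "\<dots> = (\<Sum>p\<in>disjoint_color_pairs q. \<Sum>r\<in>{r \<in> ?R. (f (fst r), f (snd r)) = p}. 1)"
  proof (intro sum.cong refl, clarify)
    fix A B assume "(A, B) \<in> disjoint_color_pairs q"
    then have "{r \<in> ?R. (f (fst r), f (snd r)) = (A, B)} = ?F A \<times> ?F B"
      by (auto simp: disjoint_color_pairs_def)
    then show "real (card (?F A)) * real (card (?F B)) = (\<Sum>r\<in>{r \<in> ?R. (f (fst r), f (snd r)) = (A, B)}. 1)"
      by (simp add: card_cartesian_product)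
  qed
  also have "\<dots> = (\<Sum>r\<in>?R. 1)"
    by (intro sum.group finR finite_disjoint_color_pairs)
      (use assms(3) in \<open>auto simp: disjoint_color_pairs_def\<close>)
  finally show ?thesis by simp
qed

lemma card_disjoint_pairs:
  assumes "finite V" "f \<in> V \<rightarrow> color_sets q"
  shows "card {(u, v). u \<in> V \<and> v \<in> V \<and> f u \<inter> f v = {}} = 2 * card (disjoint_edges V f)"
proof -
  let ?R = "{(u, v). u \<in> V \<and> v \<in> V \<and> f u \<inter> f v = {}}"
  have "finite ?R"
    by (rule finite_subset[of _ "V \<times> V"]) (use assms in auto)
  moreover have "irrefl ?R"
    using assms(2) by (force simp: irrefl_def color_sets_def)
  moreover have "sym ?R" by (auto simp: sym_def)
  ultimately have "card ?R = 2 * card ((\<lambda>(x, y). {x, y}) ` ?R)"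
    by (intro card_ordered_pairs)
  moreover have "(\<lambda>(x, y). {x, y}) ` ?R = disjoint_edges V f"
    by (auto simp: disjoint_edges_def)
  ultimately show ?thesis by simp
qed

lemma card_disjoint_edges:
  assumes "finite V" "V \<noteq> {}" "f \<in> V \<rightarrow> color_sets q"
  shows "real (card (disjoint_edges V f)) = (real (card V))\<^sup>2 * etotal q (weight V f)"
  using weight_etotal[OF assms] card_disjoint_pairs[OF assms(1,3)] by simp

lemma simple_graph_disjoint_edges:
  assumes "finite V" "f \<in> V \<rightarrow> color_sets q"
  shows "simple_graph V (disjoint_edges V f)"
proof -
  have "u \<noteq> v" if "u \<in> V" "f u \<inter> f v = {}" for u v
    using that assms(2) by (force simp: color_sets_def)
  then show ?thesis using assms(1) by (fastforce simp: simple_graph_def disjoint_edges_def)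
qed

section \<open>Colorings from products of color sets\<close>

lemma finite_simple_graph_edges: "simple_graph V E \<Longrightarrow> finite E"
  by (rule finite_subset[of _ "Pow V"]) (auto simp: simple_graph_def)

lemma finite_proper_colorings: "finite V \<Longrightarrow> finite (proper_colorings q V E)"
  unfolding proper_colorings_def
  by (rule finite_subset[OF _ finite_PiE[of V "\<lambda>_. {1..q}"]]) auto

text \<open>Adjacent vertices draw their colors from disjoint sets, so every independent choice of a
  color from each \<open>g v\<close> is proper. The exponential is the size of the product set. All
  lower bounds on the number of colorings come from here.\<close>

lemma proper_colorings_ge:
  assumes V: "finite V" and g: "g \<in> V \<rightarrow> color_sets q" and E: "simple_graph V E"
    and dis: "\<And>u v. {u, v} \<in> E \<Longrightarrow> g u \<inter> g v = {}"
  shows "real (card (proper_colorings q V E)) \<ge> exp (\<Sum>v\<in>V. ln (real (card (g v))))"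
proof -
  have "PiE V g \<subseteq> proper_colorings q V E"
  proof
    fix c assume c: "c \<in> PiE V g"
    have "c v \<in> {1..q}" if "v \<in> V" for v
    proof -
      have "c v \<in> g v" using c that by (rule PiE_mem)
      moreover have "g v \<subseteq> {1..q}" using funcset_mem[OF g that] by (simp add: color_sets_def)
      ultimately show ?thesis by blast
    qed
    then have "c \<in> V \<rightarrow>\<^sub>E {1..q}" using c by (auto simp: PiE_iff)
    moreover have "c u \<noteq> c v" if "{u, v} \<in> E" for u v
    proof -
      have "u \<in> V" "v \<in> V" using that E by (auto simp: simple_graph_def doubleton_eq_iff)
      then have "c u \<in> g u" "c v \<in> g v" using c by (auto simp: PiE_iff)
      then show ?thesis using dis[OF that] by auto
    qed
    ultimately show "c \<in> proper_colorings q V E" by (simp add: proper_colorings_def)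
  qed
  then have "card (PiE V g) \<le> card (proper_colorings q V E)"
    by (rule card_mono[OF finite_proper_colorings[OF V]])
  moreover have "exp (\<Sum>v\<in>V. ln (real (card (g v)))) = real (card (PiE V g))"
    unfolding exp_sum[OF V] card_PiE[OF V] of_nat_prod
  proof (intro prod.cong refl)
    fix v assume "v \<in> V"
    then have "card (g v) \<ge> 1" using g by (intro color_sets_card_pos) auto
    then show "exp (ln (real (card (g v)))) = real (card (g v))" by (intro exp_ln) simp
  qed
  ultimately show ?thesis by simp
qed


section \<open>The optimization problem\<close>

lemma obj_nonneg:
  assumes "\<alpha> \<in> feas q \<gamma>" shows "0 \<le> obj q \<alpha>"
  unfolding obj_def using assms ln_card_bounds by (intro sum_nonneg mult_nonneg_nonneg) (auto simp: feas_def)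

lemma feas_le_one:
  assumes "\<alpha> \<in> feas q \<gamma>" "A \<in> color_sets q" shows "\<alpha> A \<le> 1"
proof -
  have "\<alpha> A \<le> vtotal q \<alpha>"
    unfolding vtotal_def using assms by (intro member_le_sum) (auto simp: feas_def)
  then show ?thesis using assms by (simp add: feas_def)
qed

lemma feas_cong:
  assumes "\<And>A. A \<in> color_sets q \<Longrightarrow> \<alpha> A = \<beta> A"
  shows "\<alpha> \<in> feas q \<gamma> \<longleftrightarrow> \<beta> \<in> feas q \<gamma>" and "obj q \<alpha> = obj q \<beta>"
proof -
  have "2 * etotal q \<alpha> = 2 * etotal q \<beta>"
    unfolding etotal_ordered using assms by (intro sum.cong) (auto simp: disjoint_color_pairs_def)
  then show "\<alpha> \<in> feas q \<gamma> \<longleftrightarrow> \<beta> \<in> feas q \<gamma>"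
    using assms by (simp add: feas_def vtotal_def)
  show "obj q \<alpha> = obj q \<beta>"
    using assms by (simp add: obj_def)
qed

text \<open>A continuous objective attains its maximum on a compact set; this is what gives the
  \<open>GREATEST\<close> in \<open>opt\<close> its intended value.\<close>

lemma feas_attains_max:
  assumes "feas q \<gamma> \<noteq> {}"
  shows "\<exists>\<alpha>\<in>feas q \<gamma>. \<forall>\<beta>\<in>feas q \<gamma>. obj q \<beta> \<le> obj q \<alpha>"
proof -
  \<comment> \<open>Feasibility leaves coordinates outside \<open>color_sets q\<close> free, so
    \<open>feas\<close> itself is not bounded. Pinning them to 0 gives a product of compact
    sets.\<close>
  let ?box = "PiE UNIV (\<lambda>A. if A \<in> color_sets q then {0..1::real} else {0})"
  let ?K = "feas q \<gamma> \<inter> ?box"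
  have coord: "continuous_on UNIV (\<lambda>\<alpha> :: nat set \<Rightarrow> real. \<alpha> A)" for A
    by (rule continuous_on_product_coordinates)
  have contE: "continuous_on UNIV (etotal q)"
  proof -
    have "etotal q = (\<lambda>\<alpha>. (\<Sum>p\<in>disjoint_color_pairs q. \<alpha> (fst p) * \<alpha> (snd p)) / 2)"
    proof
      fix \<alpha>
      show "etotal q \<alpha> = (\<Sum>p\<in>disjoint_color_pairs q. \<alpha> (fst p) * \<alpha> (snd p)) / 2"
        using etotal_ordered[of q \<alpha>] by (simp add: case_prod_unfold)
    qed
    then show ?thesis by (auto intro!: continuous_intros coord)
  qed
  have contV: "continuous_on UNIV (vtotal q)"
    unfolding vtotal_def by (auto intro!: continuous_intros coord)
  have contO: "continuous_on UNIV (obj q)"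
    unfolding obj_def by (auto intro!: continuous_intros coord)
  have "feas q \<gamma> = (\<Inter>A\<in>color_sets q. {\<alpha>. 0 \<le> \<alpha> A}) \<inter> {\<alpha>. vtotal q \<alpha> = 1} \<inter> {\<alpha>. \<gamma> \<le> etotal q \<alpha>}"
    by (auto simp: feas_def)
  then have "closed (feas q \<gamma>)"
    by (auto intro!: closed_Int closed_INT closed_Collect_le closed_Collect_eq contE contV coord)
  moreover have "compact ?box"
  proof -
    have "compactin (product_topology (\<lambda>_. euclidean) UNIV) ?box"
      unfolding compactin_PiE by auto
    then show ?thesis by (simp add: euclidean_product_topology)
  qed
  ultimately have "compact ?K" by (rule closed_Int_compact)
  \<comment> \<open>Zeroing the irrelevant coordinates changes neither feasibility nor the
    objective, so a maximum over \<open>?K\<close> is a maximum over all of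
    \<open>feas\<close>.\<close>
  define restr :: "(nat set \<Rightarrow> real) \<Rightarrow> nat set \<Rightarrow> real" where
    "restr = (\<lambda>\<alpha> A. if A \<in> color_sets q then \<alpha> A else 0)"
  have restr: "restr \<alpha> \<in> ?K" "obj q (restr \<alpha>) = obj q \<alpha>" if "\<alpha> \<in> feas q \<gamma>" for \<alpha>
  proof -
    have eq: "\<And>A. A \<in> color_sets q \<Longrightarrow> restr \<alpha> A = \<alpha> A" by (simp add: restr_def)
    show "obj q (restr \<alpha>) = obj q \<alpha>" by (rule feas_cong(2)) (rule eq)
    have "restr \<alpha> \<in> feas q \<gamma>" using feas_cong(1)[of q "restr \<alpha>" \<alpha> \<gamma>, OF eq] that by blast
    moreover have "restr \<alpha> \<in> ?box"
      using that feas_le_one[OF that] by (auto simp: restr_def feas_def)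
    ultimately show "restr \<alpha> \<in> ?K" by blast
  qed
  then have "?K \<noteq> {}" using assms by blast
  with \<open>compact ?K\<close> obtain \<alpha> where "\<alpha> \<in> ?K" "\<forall>\<beta>\<in>?K. obj q \<beta> \<le> obj q \<alpha>"
    using continuous_attains_sup[of ?K "obj q"] continuous_on_subset[OF contO] by blast
  then show ?thesis using restr by (metis IntD1)
qed

lemma obj_le_opt:
  assumes "\<alpha> \<in> feas q \<gamma>" shows "obj q \<alpha> \<le> opt q \<gamma>"
proof -
  obtain \<beta> where b: "\<beta> \<in> feas q \<gamma>" "\<forall>\<alpha>\<in>feas q \<gamma>. obj q \<alpha> \<le> obj q \<beta>"
    using feas_attains_max assms by blast
  then have "opt q \<gamma> = obj q \<beta>"
    unfolding opt_def by (intro Greatest_equality) auto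
  then show ?thesis using b assms by simp
qed

section \<open>Stability of the optimum under relaxing the edge constraint\<close>

lemma sum_of_bool_eq:
  fixes f :: "'a \<Rightarrow> real"
  assumes "finite C" "X \<in> C"
  shows "(\<Sum>B\<in>C. of_bool (B = X) * f B) = f X"
proof -
  have "(\<Sum>B\<in>C. of_bool (B = X) * f B) = (\<Sum>B\<in>C. if B = X then f B else 0)"
    by (intro sum.cong) auto
  then show ?thesis using assms by simp
qed

text \<open>Moving mass \<open>t\<close> from \<open>A\<close> to each of two singletons inside \<open>A\<close> keeps all disjointness relations
  and creates the new disjoint pair \<open>{i}, {j}\<close>.\<close>

lemma etotal_split:
  assumes A: "A \<in> color_sets q" and ij: "i \<in> A" "j \<in> A" "i \<noteq> j"
    and nn: "\<forall>B\<in>color_sets q. 0 \<le> \<alpha> B" and t: "0 \<le> t"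
  defines "\<beta> \<equiv> (\<lambda>B. \<alpha> B + t * (of_bool (B = {i}) + of_bool (B = {j}) - 2 * of_bool (B = A)))"
  shows "etotal q \<beta> \<ge> etotal q \<alpha> + t\<^sup>2"
proof -
  let ?C = "color_sets q"
  \<comment> \<open>With unit vectors \<open>e X\<close>, the bilinear form \<open>D\<close>
    satisfies \<open>D x x = 2 * etotal q x\<close>, and \<open>d\<close> is the direction of the
    move, so \<open>\<beta>\<close> is \<open>\<alpha>\<close> plus \<open>t\<close> times
    \<open>d\<close>. The claim follows by expanding \<open>D\<close> at
    \<open>\<beta>\<close>.\<close>
  define e where "e = (\<lambda>X B :: nat set. of_bool (B = X) :: real)"
  define D where "D = (\<lambda>x y. \<Sum>B\<in>?C. \<Sum>B'\<in>?C. of_bool (B \<inter> B' = {}) * (x B * y B' :: real))"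
  define d where "d = (\<lambda>B. e {i} B + e {j} B - 2 * e A B)"
  have DE: "2 * etotal q x = D x x" for x
  proof -
    have "D x x = (\<Sum>p\<in>?C \<times> ?C. if p \<in> disjoint_color_pairs q then x (fst p) * x (snd p) else 0)"
      unfolding D_def sum.cartesian_product
      by (intro sum.cong) (auto simp: disjoint_color_pairs_def)
    also have "\<dots> = (\<Sum>p\<in>(?C \<times> ?C) \<inter> disjoint_color_pairs q. x (fst p) * x (snd p))"
      by (rule sum.inter_restrict[symmetric]) simp
    also have "(?C \<times> ?C) \<inter> disjoint_color_pairs q = disjoint_color_pairs q"
      using disjoint_color_pairs_subset by blast
    finally show ?thesis by (simp add: etotal_ordered case_prod_unfold)
  qed
  have sets: "{i} \<in> ?C" "{j} \<in> ?C" using A ij by (auto simp: color_sets_def)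
  have linear: "D x (\<lambda>B. y B + s * z B) = D x y + s * D x z"
    "D (\<lambda>B. y B + s * z B) x = D y x + s * D z x" for x y z s
    unfolding D_def by (simp_all add: algebra_simps sum.distrib sum_distrib_left)
  have sym: "D x y = D y x" for x y
    unfolding D_def by (subst sum.swap) (simp add: Int_commute mult.commute)
  have De: "D x (e X) = (\<Sum>B\<in>?C. of_bool (B \<inter> X = {}) * x B)" if "X \<in> ?C" for x X
    unfolding D_def
  proof (intro sum.cong refl)
    fix B
    have "(\<Sum>B'\<in>?C. of_bool (B \<inter> B' = {}) * (x B * e X B')) =
        (\<Sum>B'\<in>?C. of_bool (B' = X) * (of_bool (B \<inter> B' = {}) * x B))"
      by (intro sum.cong) (auto simp: e_def)
    then show "(\<Sum>B'\<in>?C. of_bool (B \<inter> B' = {}) * (x B * e X B')) = of_bool (B \<inter> X = {}) * x B"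
      using that by (simp only: sum_of_bool_eq[OF finite_color_sets])
  qed
  have Dee: "D (e Y) (e X) = of_bool (Y \<inter> X = {})" if "X \<in> ?C" "Y \<in> ?C" for X Y
    using sum_of_bool_eq[OF finite_color_sets that(2), of "\<lambda>B. of_bool (B \<inter> X = {})"]
    unfolding De[OF that(1)] by (simp only: e_def mult.commute)
  have Dd: "D x d = D x (e {i}) + D x (e {j}) - 2 * D x (e A)" for x
    unfolding D_def d_def by (simp add: algebra_simps sum.distrib sum_distrib_left sum_subtractf)
  have "D \<alpha> d = (\<Sum>B\<in>?C. (of_bool (B \<inter> {i} = {}) + of_bool (B \<inter> {j} = {}) - 2 * of_bool (B \<inter> A = {})) * \<alpha> B)"
    unfolding Dd De[OF A] De[OF sets(1)] De[OF sets(2)]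
    by (simp add: algebra_simps sum.distrib sum_distrib_left sum_subtractf del: sum_mult_of_bool_eq sum_of_bool_mult_eq)
  \<comment> \<open>A set disjoint from \<open>A\<close> is disjoint from \<open>{i}\<close> and
    from \<open>{j}\<close>, so every coefficient is nonnegative.\<close>
  also have "\<dots> \<ge> 0"
    using nn ij by (intro sum_nonneg mult_nonneg_nonneg) auto
  finally have Dad: "D \<alpha> d \<ge> 0" .
  have Dxd: "D (e X) d = of_bool (X \<inter> {i} = {}) + of_bool (X \<inter> {j} = {}) - 2 * of_bool (X \<inter> A = {})"
    if "X \<in> ?C" for X
    unfolding Dd using that A sets by (simp add: Dee)
  have "D d d = D d (e {i}) + D d (e {j}) - 2 * D d (e A)" by (rule Dd)
  also have "\<dots> = D (e {i}) d + D (e {j}) d - 2 * D (e A) d" by (simp only: sym[of d])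
  \<comment> \<open>Among \<open>{i}\<close>, \<open>{j}\<close> and \<open>A\<close> the only
    disjoint pair is \<open>{i}\<close>, \<open>{j}\<close>, counted once in each order.\<close>
  also have "\<dots> = 2"
    unfolding Dxd[OF A] Dxd[OF sets(1)] Dxd[OF sets(2)] using ij by auto
  finally have Ddd: "D d d = 2" .
  have "\<beta> = (\<lambda>B. \<alpha> B + t * d B)" by (simp add: \<beta>_def d_def e_def)
  then have "D \<beta> \<beta> = D \<alpha> \<alpha> + 2 * t * D \<alpha> d + t * (t * D d d)"
    by (simp add: linear sym[of d \<alpha>] algebra_simps)
  also have "\<dots> \<ge> D \<alpha> \<alpha> + 2 * t\<^sup>2"
    using Dad Ddd t by (simp add: power2_eq_square)
  finally show ?thesis using DE[of \<alpha>] DE[of \<beta>] by simp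
qed

text \<open>If the sets with at least two colors carry little mass, the objective value is small anyway;
  otherwise one of them is heavy enough to be split, which gains a constant in \<open>etotal\<close>.\<close>

lemma opt_robust:
  assumes "q \<ge> 2" "\<epsilon> > 0"
  obtains \<eta> where "\<eta> > 0" and
    "\<And>\<gamma> \<alpha>. feas q \<gamma> \<noteq> {} \<Longrightarrow> \<alpha> \<in> feas q (\<gamma> - \<eta>) \<Longrightarrow> obj q \<alpha> \<le> opt q \<gamma> + \<epsilon>"
proof -
  let ?C = "color_sets q"
  define L where "L = ln (real q)"
  define N where "N = real (card ?C)"
  have Lpos: "L > 0" using assms by (simp add: L_def)
  have "{1} \<in> ?C" using assms by (auto simp: color_sets_def)
  then have Npos: "N > 0" by (auto simp: N_def card_gt_0_iff)
  \<comment> \<open>If every set with at least two colors has mass at most \<open>a\<close>, the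
    objective is at most \<open>N * a * L\<close>, which is \<open>\<epsilon>\<close>.\<close>
  define a where "a = \<epsilon> / (N * L)"
  have apos: "a > 0" using Lpos Npos assms by (simp add: a_def)
  \<comment> \<open>The first bound keeps the split coordinate nonnegative, the second limits the
    loss \<open>2 * t * ln (card A)\<close> of the objective to \<open>\<epsilon>\<close>.\<close>
  define t where "t = min (a / 2) (\<epsilon> / (2 * L))"
  have t: "t > 0" "2 * t \<le> a" "2 * t * L \<le> \<epsilon>"
    using apos Lpos assms by (auto simp: t_def min_def field_simps)
  show thesis
  proof (rule that[of "t\<^sup>2"])
    show "t\<^sup>2 > 0" using t by simp
    fix \<gamma> \<alpha> assume ne: "feas q \<gamma> \<noteq> {}" and \<alpha>: "\<alpha> \<in> feas q (\<gamma> - t\<^sup>2)"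
    have nn: "\<forall>B\<in>?C. 0 \<le> \<alpha> B" using \<alpha> by (simp add: feas_def)
    show "obj q \<alpha> \<le> opt q \<gamma> + \<epsilon>"
    proof (cases "\<exists>A\<in>?C. card A \<ge> 2 \<and> \<alpha> A \<ge> a")
      case False
      have "\<alpha> B * ln (real (card B)) \<le> a * L" if "B \<in> ?C" for B
      proof (cases "card B \<ge> 2")
        case True
        then have "\<alpha> B \<le> a" using False that by force
        then show ?thesis using ln_card_bounds[OF that] nn that apos
          by (intro mult_mono) (auto simp: L_def)
      next
        case False
        then have "card B = 1" using color_sets_card_pos[OF that] by simp
        then show ?thesis using apos Lpos by simp
      qed
      then have "obj q \<alpha> \<le> (\<Sum>B\<in>?C. a * L)"
        unfolding obj_def by (rule sum_mono)
      also have "\<dots> = N * (a * L)" by (simp add: N_def)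
      also have "\<dots> = \<epsilon>" using Npos Lpos by (simp add: a_def)
      \<comment> \<open>Any feasible vector has nonnegative objective, so the optimum is at least
        0.\<close>
      also obtain \<beta> where "\<beta> \<in> feas q \<gamma>" using ne by blast
      then have "\<epsilon> \<le> opt q \<gamma> + \<epsilon>" using obj_nonneg obj_le_opt by force
      finally show ?thesis .
    next
      case True
      then obtain A where A: "A \<in> ?C" "card A \<ge> 2" "\<alpha> A \<ge> a" by blast
      obtain T where "T \<subseteq> A" "card T = 2" using obtain_subset_with_card_n[OF A(2)] by blast
      then obtain i j where ij: "i \<in> A" "j \<in> A" "i \<noteq> j" by (auto simp: card_2_iff)
      define \<beta> where "\<beta> = (\<lambda>B. \<alpha> B + t * (of_bool (B = {i}) + of_bool (B = {j}) - 2 * of_bool (B = A)))"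
      have sets: "{i} \<in> ?C" "{j} \<in> ?C" using A ij by (auto simp: color_sets_def)
      have sumi: "(\<Sum>B\<in>?C. of_bool (B = X) * f B) = f X" if "X \<in> ?C" for X and f :: "nat set \<Rightarrow> real"
        using that by (rule sum_of_bool_eq[OF finite_color_sets])
      have "etotal q \<beta> \<ge> etotal q \<alpha> + t\<^sup>2"
        unfolding \<beta>_def using A(1) ij nn less_imp_le[OF t(1)] by (rule etotal_split)
      moreover have "vtotal q \<beta> = vtotal q \<alpha>"
        using sumi[OF sets(1), of "\<lambda>_. 1"] sumi[OF sets(2), of "\<lambda>_. 1"] sumi[OF A(1), of "\<lambda>_. 1"]
        by (simp add: vtotal_def \<beta>_def sum.distrib sum_subtractf flip: sum_distrib_left)
      moreover have "0 \<le> \<beta> B" if "B \<in> ?C" for B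
        using nn that A t ij by (auto simp: \<beta>_def of_bool_def algebra_simps intro: order_trans)
      ultimately have "\<beta> \<in> feas q \<gamma>" using \<alpha> by (auto simp: feas_def)
      then have "obj q \<beta> \<le> opt q \<gamma>" by (rule obj_le_opt)
      moreover have "obj q \<beta> = obj q \<alpha> - 2 * t * ln (real (card A))"
      proof -
        have "obj q \<beta> = obj q \<alpha> + t * ((\<Sum>B\<in>?C. of_bool (B = {i}) * ln (real (card B)))
           + (\<Sum>B\<in>?C. of_bool (B = {j}) * ln (real (card B)))
           - 2 * (\<Sum>B\<in>?C. of_bool (B = A) * ln (real (card B))))"
          by (simp add: obj_def \<beta>_def algebra_simps sum.distrib sum_subtractf sum_distrib_left
              del: sum_mult_of_bool_eq sum_of_bool_mult_eq)
        then show ?thesis unfolding sumi[OF sets(1)] sumi[OF sets(2)] sumi[OF A(1)] by simp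
      qed
      moreover have "2 * t * ln (real (card A)) \<le> 2 * t * L"
        using ln_card_bounds[OF A(1)] t by (simp add: L_def)
      ultimately show ?thesis using t by linarith
    qed
  qed
qed


section \<open>Containers and the upper bound\<close>

text \<open>\<open>container V E b S\<close> collects all vertices that can still occur in an independent set whose
  greedy fingerprint is \<open>S\<close>.\<close>

definition nbrs :: "'v set \<Rightarrow> 'v set set \<Rightarrow> 'v set \<Rightarrow> 'v set" where
  "nbrs V E S = {v \<in> V. \<exists>u\<in>S. {u, v} \<in> E}"

definition container :: "'v set \<Rightarrow> 'v set set \<Rightarrow> real \<Rightarrow> 'v set \<Rightarrow> 'v set" where
  "container V E b S = {v \<in> V - nbrs V E S. real (card (nbrs V E {v} - nbrs V E S)) < b}"

lemma finite_nbrs [simp]: "finite V \<Longrightarrow> finite (nbrs V E S)"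
  by (simp add: nbrs_def)

text \<open>A container avoids \<open>nbrs V E S\<close>, and each of its vertices has fewer than
  \<open>b\<close> neighbors outside that set; hence each vertex begins fewer than \<open>b\<close>
  of these pairs.\<close>

lemma card_container_pairs:
  assumes "finite V" "b \<ge> 0"
  shows "real (card {(u, v). u \<in> container V E b S \<and> v \<in> container V E b S \<and> {u, v} \<in> E})
    \<le> b * real (card V)"
proof -
  let ?C = "container V E b S"
  have finC: "finite ?C" "?C \<subseteq> V" using assms by (auto simp: container_def)
  have "{(u, v). u \<in> ?C \<and> v \<in> ?C \<and> {u, v} \<in> E} \<subseteq> (SIGMA u:?C. nbrs V E {u} - nbrs V E S)"
    by (auto simp: container_def nbrs_def)
  then have "card {(u, v). u \<in> ?C \<and> v \<in> ?C \<and> {u, v} \<in> E} \<le> card (SIGMA u:?C. nbrs V E {u} - nbrs V E S)"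
    using assms finC by (intro card_mono) auto
  also have "\<dots> = (\<Sum>u\<in>?C. card (nbrs V E {u} - nbrs V E S))"
    using assms finC by (intro card_SigmaI) auto
  finally have "real (card {(u, v). u \<in> ?C \<and> v \<in> ?C \<and> {u, v} \<in> E})
      \<le> (\<Sum>u\<in>?C. real (card (nbrs V E {u} - nbrs V E S)))"
    by (simp flip: of_nat_sum)
  also have "\<dots> \<le> (\<Sum>u\<in>?C. b)"
    by (intro sum_mono) (auto simp: container_def)
  also have "\<dots> \<le> b * real (card V)"
    using card_mono[OF assms(1) finC(2)] assms(2) by (simp add: mult.commute mult_left_mono)
  finally show ?thesis .
qed

text \<open>The fingerprint is a largest \<open>S \<subseteq> I\<close> each of whose vertices contributes \<open>b\<close> new neighbors.\<close>

lemma container_exists: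
  assumes V: "finite V" and I: "I \<subseteq> V" "\<And>u v. u \<in> I \<Longrightarrow> v \<in> I \<Longrightarrow> {u, v} \<notin> E" and b: "b > 0"
  shows "\<exists>S\<subseteq>I. real (card S) * b \<le> real (card V) \<and> I \<subseteq> container V E b S"
proof -
  define good where "good S \<longleftrightarrow> S \<subseteq> I \<and> real (card S) * b \<le> real (card (nbrs V E S))" for S
  have finI: "finite I" using V I finite_subset by blast
  have "good {}" by (simp add: good_def)
  moreover have "\<forall>S. good S \<longrightarrow> card S < Suc (card I)"
    using finI by (auto simp: good_def less_Suc_eq_le intro: card_mono)
  ultimately obtain S where S: "good S" and max: "\<And>S'. good S' \<Longrightarrow> card S' \<le> card S"
    using ex_has_greatest_nat[of good "{}" card "Suc (card I)"] by auto
  have "v \<in> container V E b S" if v: "v \<in> I" for v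
  proof (rule ccontr)
    assume "v \<notin> container V E b S"
    \<comment> \<open>Since \<open>S\<close> lies in the independent set \<open>I\<close>, no vertex
      of \<open>I\<close> is a neighbor of \<open>S\<close>. Such a vertex is excluded only if it
      has at least \<open>b\<close> new neighbors, and then adding it would contradict
      maximality.\<close>
    moreover have "v \<in> V - nbrs V E S" using v I S by (auto simp: nbrs_def good_def)
    ultimately have new: "b \<le> real (card (nbrs V E {v} - nbrs V E S))"
      by (auto simp: container_def)
    have "v \<notin> S"
    proof
      assume "v \<in> S"
      then have "nbrs V E {v} - nbrs V E S = {}" by (auto simp: nbrs_def)
      then have "card (nbrs V E {v} - nbrs V E S) = 0" by (simp only: card.empty)
      then show False using new b by simp
    qed
    have finS: "finite S" using S finI by (auto simp: good_def intro: finite_subset)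
    have "nbrs V E (insert v S) = nbrs V E S \<union> (nbrs V E {v} - nbrs V E S)"
      by (auto simp: nbrs_def)
    then have "card (nbrs V E (insert v S)) = card (nbrs V E S) + card (nbrs V E {v} - nbrs V E S)"
      using V by (simp only:) (rule card_Un_disjoint, auto)
    then have "good (insert v S)"
      using S v new \<open>v \<notin> S\<close> finS by (auto simp: good_def algebra_simps)
    from max[OF this] show False using \<open>v \<notin> S\<close> finS by simp
  qed
  then have "I \<subseteq> container V E b S" by blast
  moreover have "real (card S) * b \<le> real (card V)"
  proof -
    have "card (nbrs V E S) \<le> card V"
      using V by (intro card_mono) (auto simp: nbrs_def)
    then show ?thesis using S by (simp add: good_def)
  qed
  moreover have "S \<subseteq> I" using S by (simp add: good_def)
  ultimately show ?thesis by blast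
qed

text \<open>Small subsets are enumerated by short lists. For fixed \<open>k\<close> the bound is
  polynomial in \<open>card V\<close>, so fingerprints are cheap to choose.\<close>

lemma card_bounded_subsets_le:
  assumes "finite V"
  shows "card {S. S \<subseteq> V \<and> card S \<le> k} \<le> (card V + 1) ^ k"
proof -
  have "{S. S \<subseteq> V \<and> card S \<le> k} \<subseteq> set ` {xs. set xs \<subseteq> V \<and> length xs \<le> k}"
  proof
    fix S assume "S \<in> {S. S \<subseteq> V \<and> card S \<le> k}"
    moreover from this obtain xs where "set xs = S" "distinct xs"
      using finite_distinct_list assms finite_subset by blast
    ultimately show "S \<in> set ` {xs. set xs \<subseteq> V \<and> length xs \<le> k}"
      by (auto simp: distinct_card intro!: image_eqI[of _ _ xs])
  qed
  then have "card {S. S \<subseteq> V \<and> card S \<le> k} \<le> card {xs. set xs \<subseteq> V \<and> length xs \<le> k}"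
    by (rule surj_card_le[OF finite_lists_length_le[OF assms]])
  also have "\<dots> = (\<Sum>i\<le>k. card V ^ i)" by (rule card_lists_length_le[OF assms])
  also have "\<dots> \<le> (card V + 1) ^ k"
  proof (induction k)
    case (Suc k)
    have "card V * card V ^ k \<le> card V * (card V + 1) ^ k" by (intro mult_left_mono power_mono) auto
    with Suc have "(\<Sum>i\<le>k. card V ^ i) + card V * card V ^ k \<le> (card V + 1) ^ k + card V * (card V + 1) ^ k"
      by (rule add_mono)
    then show ?case by simp
  qed simp
  finally show ?thesis .
qed

text \<open>With threshold \<open>\<delta> * n\<close>, a fingerprint has at most
  \<open>1 / \<delta>\<close> vertices, and one is chosen per color; this gives the polynomial
  factor. Each container spans at most \<open>\<delta> * n^2\<close> ordered adjacent pairs, hence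
  half as many edges, which over \<open>q\<close> colors explains the relaxation
  \<open>q * \<delta> / 2\<close> in \<open>bound\<close>.\<close>

lemma colorings_le:
  fixes E :: "'v set set"
  assumes graph: "simple_graph V E" "V \<noteq> {}" and \<delta>: "\<delta> > 0"
    and bound: "\<And>\<alpha>. \<alpha> \<in> feas q (real (card E) / (real (card V))\<^sup>2 - real q * \<delta> / 2) \<Longrightarrow> obj q \<alpha> \<le> M"
  shows "real (card (proper_colorings q V E))
    \<le> real (card V + 1) ^ (nat \<lfloor>1 / \<delta>\<rfloor> * q) * exp (real (card V) * M)"
proof -
  define n where "n = card V"
  define K where "K = nat \<lfloor>1 / \<delta>\<rfloor>"
  define Fp where "Fp = {S. S \<subseteq> V \<and> card S \<le> K}"
  define cont where "cont = container V E (\<delta> * real n)"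
  define f where "f S v = {i \<in> {1..q}. v \<in> cont (S i)}" for S :: "nat \<Rightarrow> 'v set" and v
  have V: "finite V" using graph by (simp add: simple_graph_def)
  have n0: "n > 0" using V graph by (simp add: n_def card_gt_0_iff)
  have finE: "finite E" by (rule finite_simple_graph_edges[OF graph(1)])
  have finFp: "finite Fp" using V by (simp add: Fp_def)
  have fin_f: "finite (f S v)" for S v by (simp add: f_def)
  have cover: "proper_colorings q V E \<subseteq> (\<Union>S\<in>{1..q} \<rightarrow>\<^sub>E Fp. PiE V (f S))"
  proof
    fix c assume c: "c \<in> proper_colorings q V E"
    have "\<exists>S\<in>Fp. {v \<in> V. c v = i} \<subseteq> cont S" for i
    proof -
      have "\<exists>S\<subseteq>{v \<in> V. c v = i}. real (card S) * (\<delta> * real n) \<le> real n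
          \<and> {v \<in> V. c v = i} \<subseteq> cont S"
        unfolding n_def cont_def
      proof (rule container_exists[OF V])
        fix u v assume "u \<in> {v \<in> V. c v = i}" "v \<in> {v \<in> V. c v = i}"
        then have "c u = c v" by simp
        then show "{u, v} \<notin> E" using c unfolding proper_colorings_def by blast
      qed (use \<delta> n0 in \<open>auto simp: n_def\<close>)
      then obtain S where S: "S \<subseteq> {v \<in> V. c v = i}" "real (card S) * (\<delta> * real n) \<le> real n"
          "{v \<in> V. c v = i} \<subseteq> cont S" by blast
      have "real (card S) \<le> 1 / \<delta>" using S(2) \<delta> n0 by (simp add: field_simps)
      then have "card S \<le> K" unfolding K_def by linarith
      then show ?thesis using S by (auto simp: Fp_def)
    qed
    then obtain S where S: "\<And>i. S i \<in> Fp" "\<And>i. {v \<in> V. c v = i} \<subseteq> cont (S i)" by metis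
    \<comment> \<open>Restriction to the colors makes the tuple of fingerprints a member of the
      finite set \<open>{1..q} \<rightarrow>\<^sub>E Fp\<close>.\<close>
    have "c v \<in> f (restrict S {1..q}) v" if "v \<in> V" for v
      using that S(2)[of "c v"] c by (auto simp: f_def proper_colorings_def PiE_iff)
    then have "c \<in> PiE V (f (restrict S {1..q}))"
      using c by (auto simp: proper_colorings_def PiE_iff)
    moreover have "restrict S {1..q} \<in> {1..q} \<rightarrow>\<^sub>E Fp" using S(1) by auto
    ultimately show "c \<in> (\<Union>S\<in>{1..q} \<rightarrow>\<^sub>E Fp. PiE V (f S))" by blast
  qed
  have each: "real (card (PiE V (f S))) \<le> exp (real n * M)" for S
  \<comment> \<open>A vertex left without colors makes the product set empty; otherwise
    \<open>f S\<close> maps into the color sets and its \<open>weight\<close> is available.\<close>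
  proof (cases "\<exists>v\<in>V. f S v = {}")
    case True
    then have "PiE V (f S) = {}" by (auto simp: PiE_eq_empty_iff)
    then show ?thesis by simp
  next
    case False
    then have fS: "f S \<in> V \<rightarrow> color_sets q" by (auto simp: color_sets_def f_def)
    let ?O = "{(u, v). {u, v} \<in> E}"
    let ?D = "{(u, v). u \<in> V \<and> v \<in> V \<and> f S u \<inter> f S v = {}}"
    let ?B = "\<lambda>i. {(u, v). u \<in> cont (S i) \<and> v \<in> cont (S i) \<and> {u, v} \<in> E}"
    have O: "?O \<subseteq> V \<times> V" "irrefl ?O" "sym ?O"
      using graph by (auto simp: simple_graph_def doubleton_eq_iff irrefl_def sym_def insert_commute)
    have "(\<lambda>(u, v). {u, v}) ` ?O = E"
      using graph by (force simp: simple_graph_def)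
    then have cardO: "card ?O = 2 * card E"
      using card_ordered_pairs[OF finite_subset[OF O(1)] O(3,2)] V by simp
    have finB: "finite (?B i)" for i
      by (rule finite_subset[OF _ finite_subset[OF O(1)]]) (use V in auto)
    have finD: "finite ?D" by (rule finite_subset[of _ "V \<times> V"]) (use V in auto)
    \<comment> \<open>If the ends of an edge share an available color \<open>i\<close>, both lie in
      the container of color \<open>i\<close>.\<close>
    have "?O \<subseteq> ?D \<union> (\<Union>i\<in>{1..q}. ?B i)"
      using O(1) by (auto simp: f_def)
    then have "card ?O \<le> card (?D \<union> (\<Union>i\<in>{1..q}. ?B i))"
      using finB finD by (intro card_mono) auto
    also have "\<dots> \<le> card ?D + card (\<Union>i\<in>{1..q}. ?B i)" by (rule card_Un_le)
    also have "card (\<Union>i\<in>{1..q}. ?B i) \<le> (\<Sum>i\<in>{1..q}. card (?B i))" by (rule card_UN_le) simp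
    finally have "2 * real (card E) \<le> real (card ?D) + (\<Sum>i\<in>{1..q}. real (card (?B i)))"
      unfolding cardO by (simp flip: of_nat_sum of_nat_add of_nat_mult)
    also have "(\<Sum>i\<in>{1..q}. real (card (?B i))) \<le> (\<Sum>i\<in>{1..q}. \<delta> * real n * real n)"
      unfolding cont_def n_def using V \<delta> by (intro sum_mono card_container_pairs) auto
    also have "real (card ?D) = 2 * (real n)\<^sup>2 * etotal q (weight V (f S))"
      unfolding n_def by (rule weight_etotal[OF V graph(2) fS, symmetric])
    finally have "real (card E) / (real n)\<^sup>2 - real q * \<delta> / 2 \<le> etotal q (weight V (f S))"
      using n0 by (simp add: field_simps power2_eq_square)
    then have "weight V (f S) \<in> feas q (real (card E) / (real (card V))\<^sup>2 - real q * \<delta> / 2)"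
      using weight_vtotal[OF V graph(2) fS] by (simp add: feas_def weight_nonneg n_def)
    from bound[OF this] have "real n * obj q (weight V (f S)) \<le> real n * M"
      by (simp add: mult_left_mono)
    moreover have "real (card (PiE V (f S))) = exp (real n * obj q (weight V (f S)))"
      unfolding n_def weight_obj[OF V graph(2) fS] exp_sum[OF V] card_PiE[OF V] of_nat_prod
      using False fin_f by (intro prod.cong) (auto simp: card_gt_0_iff)
    ultimately show ?thesis by simp
  qed
  have "card (proper_colorings q V E) \<le> card (\<Union>S\<in>{1..q} \<rightarrow>\<^sub>E Fp. PiE V (f S))"
    using finFp V fin_f by (intro card_mono cover finite_UN_I finite_PiE) auto
  also have "\<dots> \<le> (\<Sum>S\<in>{1..q} \<rightarrow>\<^sub>E Fp. card (PiE V (f S)))"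
    using finFp by (intro card_UN_le finite_PiE) auto
  finally have "real (card (proper_colorings q V E)) \<le> (\<Sum>S\<in>{1..q} \<rightarrow>\<^sub>E Fp. real (card (PiE V (f S))))"
    by (simp flip: of_nat_sum)
  also have "\<dots> \<le> (\<Sum>S\<in>{1..q} \<rightarrow>\<^sub>E Fp. exp (real n * M))"
    by (rule sum_mono[OF each])
  also have "\<dots> = real (card Fp ^ q) * exp (real n * M)"
    by (simp add: card_PiE)
  also have "\<dots> \<le> real (((n + 1) ^ K) ^ q) * exp (real n * M)"
    unfolding Fp_def n_def using card_bounded_subsets_le[OF V, of K]
    by (intro mult_right_mono) (simp_all add: power_mono del: of_nat_power)
  finally show ?thesis by (simp add: n_def K_def power_mult flip: of_nat_Suc)
qed

section \<open>Polynomial factors are negligible\<close>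

lemma polynomial_below_exp:
  fixes \<epsilon> :: real
  assumes "\<epsilon> > 0"
  shows "\<forall>\<^sub>F n in sequentially. real (n + 1) ^ k < exp (\<epsilon> * real n)"
proof -
  have "(\<lambda>n. real (n + 1) ^ k / exp (\<epsilon> * real n)) \<longlonglongrightarrow> 0"
    using assms by real_asymp
  then have "\<forall>\<^sub>F n in sequentially. real (n + 1) ^ k / exp (\<epsilon> * real n) < 1"
    by (rule order_tendstoD) simp
  then show ?thesis by eventually_elim (simp add: field_simps)
qed


section \<open>Turan graphs\<close>

text \<open>Reading each part index as a one-element color set turns a Turan graph into an instance
  of \<open>disjoint_edges\<close>, so the results on vertex maps apply to it.\<close>

lemma turan_graph_disjoint_edges:
  assumes "turan_graph q V E"
  obtains part where "finite V" "part \<in> V \<rightarrow> {1..q}" "E = disjoint_edges V (\<lambda>v. {part v})"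
    "(\<lambda>v. {part v}) \<in> V \<rightarrow> color_sets q"
    "\<And>i. i \<in> {1..q} \<Longrightarrow> int (card {v \<in> V. part v = i})
       \<in> {\<lfloor>real (card V) / real q\<rfloor>, \<lceil>real (card V) / real q\<rceil>}"
proof -
  obtain part where part: "part \<in> V \<rightarrow> {1..q}" "E = {{u, v} | u v. u \<in> V \<and> v \<in> V \<and> part u \<noteq> part v}"
    "\<forall>i\<in>{1..q}. int (card {v \<in> V. part v = i})
       \<in> {\<lfloor>real (card V) / real q\<rfloor>, \<lceil>real (card V) / real q\<rceil>}"
    using assms unfolding turan_graph_def by blast
  have "E = disjoint_edges V (\<lambda>v. {part v})"
    unfolding part(2) disjoint_edges_def by (rule Collect_cong) auto
  moreover have "(\<lambda>v. {part v}) \<in> V \<rightarrow> color_sets q"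
    using part(1) by (auto simp: color_sets_def)
  ultimately show thesis using that[of part] part assms by (simp add: turan_graph_def)
qed

text \<open>Every part size is a root of \<open>(x - lo) * (x - hi)\<close>, so the sum of the squared part sizes is
  determined by their sum.\<close>

lemma turan_graph_card:
  assumes "turan_graph q V E"
  defines "lo \<equiv> \<lfloor>real (card V) / real q\<rfloor>" and "hi \<equiv> \<lceil>real (card V) / real q\<rceil>"
  shows "2 * int (card E) = (int (card V))\<^sup>2 - (lo + hi) * int (card V) + int q * lo * hi"
proof -
  obtain part where V: "finite V" and part: "part \<in> V \<rightarrow> {1..q}" and E: "E = disjoint_edges V (\<lambda>v. {part v})"
    and cs: "(\<lambda>v. {part v}) \<in> V \<rightarrow> color_sets q"
    and size: "\<And>i. i \<in> {1..q} \<Longrightarrow> int (card {v \<in> V. part v = i}) \<in> {lo, hi}"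
    using turan_graph_disjoint_edges[OF assms(1)] unfolding lo_def hi_def by blast
  define c where "c i = int (card {v \<in> V. part v = i})" for i
  have sumc: "(\<Sum>i\<in>{1..q}. c i * g i) = (\<Sum>v\<in>V. g (part v))" for g :: "nat \<Rightarrow> int"
  proof -
    have "(\<Sum>v\<in>V. g (part v)) = (\<Sum>i\<in>{1..q}. \<Sum>v\<in>{v \<in> V. part v = i}. g (part v))"
      using V part by (intro sum.group[symmetric]) auto
    also have "\<dots> = (\<Sum>i\<in>{1..q}. c i * g i)"
      by (intro sum.cong) (auto simp: c_def)
    finally show ?thesis by simp
  qed
  have "{(u, v). u \<in> V \<and> v \<in> V \<and> {part u} \<inter> {part v} = {}} = (SIGMA u:V. {v \<in> V. part v \<noteq> part u})"
    by auto
  then have "2 * card E = card (SIGMA u:V. {v \<in> V. part v \<noteq> part u})"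
    using card_disjoint_pairs[OF V cs] E by simp
  also have "\<dots> = (\<Sum>u\<in>V. card {v \<in> V. part v \<noteq> part u})"
    using V by (intro card_SigmaI) auto
  finally have "2 * int (card E) = (\<Sum>u\<in>V. int (card {v \<in> V. part v \<noteq> part u}))"
    by (simp flip: of_nat_sum)
  \<comment> \<open>The degree of a vertex is \<open>card V\<close> minus the size of its own
    part.\<close>
  also have "\<dots> = (\<Sum>u\<in>V. int (card V) - c (part u))"
  proof (intro sum.cong refl)
    fix u
    have "card V = card ({v \<in> V. part v \<noteq> part u} \<union> {v \<in> V. part v = part u})"
      by (rule arg_cong[of _ _ card]) auto
    also have "\<dots> = card {v \<in> V. part v \<noteq> part u} + card {v \<in> V. part v = part u}"
      using V by (intro card_Un_disjoint) auto
    finally show "int (card {v \<in> V. part v \<noteq> part u}) = int (card V) - c (part u)"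
      by (simp add: c_def)
  qed
  also have "\<dots> = (int (card V))\<^sup>2 - (\<Sum>i\<in>{1..q}. c i * c i)"
    using sumc[of c] by (simp add: sum_subtractf power2_eq_square)
  also have "(\<Sum>i\<in>{1..q}. c i * c i) = (\<Sum>i\<in>{1..q}. c i * (lo + hi) - lo * hi)"
  proof (intro sum.cong refl)
    fix i assume "i \<in> {1..q}"
    then have "c i = lo \<or> c i = hi" using size by (simp add: c_def)
    then show "c i * c i = c i * (lo + hi) - lo * hi" by (auto simp: algebra_simps)
  qed
  also have "\<dots> = (lo + hi) * int (card V) - int q * lo * hi"
    using sumc[of "\<lambda>_. lo + hi"] by (simp add: sum_subtractf mult.commute)
  finally show ?thesis by simp
qed

text \<open>Pull the partition back along a bijection. Construction 2 may need a Turan graph on a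
  vertex set other than the given one.\<close>

lemma turan_graph_transfer:
  fixes W :: "'w set"
  assumes "turan_graph q V E" "finite W" "card W = card V"
  shows "\<exists>E'. turan_graph q W E'"
proof -
  obtain part where V: "finite V" and part: "part \<in> V \<rightarrow> {1..q}"
    and size: "\<And>i. i \<in> {1..q} \<Longrightarrow> int (card {v \<in> V. part v = i})
       \<in> {\<lfloor>real (card V) / real q\<rfloor>, \<lceil>real (card V) / real q\<rceil>}"
    using turan_graph_disjoint_edges[OF assms(1)] by blast
  obtain h where h: "bij_betw h W V"
    using finite_same_card_bij assms V by metis
  have "card {w \<in> W. (part \<circ> h) w = i} = card {v \<in> V. part v = i}" for i
  proof (rule bij_betw_same_card[of h])
    show "bij_betw h {w \<in> W. (part \<circ> h) w = i} {v \<in> V. part v = i}"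
      using h by (auto simp: bij_betw_def inj_on_def)
  qed
  moreover have "part \<circ> h \<in> W \<rightarrow> {1..q}"
    using part bij_betwE[OF h] by auto
  ultimately show ?thesis
    unfolding turan_graph_def using assms size by (intro exI conjI bexI[of _ "part \<circ> h"] refl) auto
qed

text \<open>The part sizes of the Turan graph, as masses on singletons, form a feasible vector. This
  supplies the nonemptiness that \<open>opt_robust\<close> asks for.\<close>

lemma turan_graph_feas:
  assumes "turan_graph q V E" "V \<noteq> {}" "m \<le> card E"
  shows "feas q (real m / (real (card V))\<^sup>2) \<noteq> {}"
proof -
  obtain part where V: "finite V" and E: "E = disjoint_edges V (\<lambda>v. {part v})"
    and cs: "(\<lambda>v. {part v}) \<in> V \<rightarrow> color_sets q"
    using turan_graph_disjoint_edges[OF assms(1)] by blast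
  have "real (card V) > 0" using V assms by (simp add: card_gt_0_iff)
  then have "real m / (real (card V))\<^sup>2 \<le> etotal q (weight V (\<lambda>v. {part v}))"
    using card_disjoint_edges[OF V assms(2) cs] assms(3) E by (simp add: field_simps)
  then have "weight V (\<lambda>v. {part v}) \<in> feas q (real m / (real (card V))\<^sup>2)"
    using weight_vtotal[OF V assms(2) cs] by (simp add: feas_def weight_nonneg)
  then show ?thesis by blast
qed


section \<open>Existence of the constructions\<close>

text \<open>Round everything down; the deficit is at most the number of non-integral entries, so
  raising that many of them by one repairs the sum. Integral entries are left alone because raising
  one would give an error of exactly 1.\<close>

lemma rounding_exists:
  fixes x :: "'a \<Rightarrow> real"
  assumes I: "finite I" and x: "\<And>i. i \<in> I \<Longrightarrow> 0 \<le> x i" and sum: "(\<Sum>i\<in>I. x i) = real n"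
  shows "\<exists>c :: 'a \<Rightarrow> nat. (\<Sum>i\<in>I. c i) = n \<and> (\<forall>i\<in>I. \<bar>x i - real (c i)\<bar> < 1)"
proof -
  define b where "b i = nat \<lfloor>x i\<rfloor>" for i
  define J where "J = {i \<in> I. real (b i) < x i}"
  have b: "real (b i) \<le> x i" "x i < real (b i) + 1" if "i \<in> I" for i
    using x[OF that] by (auto simp: b_def)
  have finJ: "finite J" "J \<subseteq> I" using I by (auto simp: J_def)
  have "real (\<Sum>i\<in>I. b i) \<le> (\<Sum>i\<in>I. x i)" unfolding of_nat_sum using b by (intro sum_mono) auto
  then have le: "(\<Sum>i\<in>I. b i) \<le> n" unfolding sum of_nat_le_iff .
  have "real n - real (\<Sum>i\<in>I. b i) = (\<Sum>i\<in>I. x i - real (b i))"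
    using sum by (simp add: sum_subtractf)
  also have "\<dots> \<le> (\<Sum>i\<in>I. if i \<in> J then 1 else 0)"
    using b by (intro sum_mono) (auto simp: J_def less_imp_le algebra_simps not_less)
  also have "\<dots> = real (card J)"
    using finJ I by (simp add: sum.If_cases Int_absorb1)
  finally have "n - (\<Sum>i\<in>I. b i) \<le> card J" by linarith
  then obtain J' where J': "J' \<subseteq> J" "card J' = n - (\<Sum>i\<in>I. b i)"
    using obtain_subset_with_card_n by metis
  define c where "c i = b i + of_bool (i \<in> J')" for i
  have "(\<Sum>i\<in>I. of_bool (i \<in> J')) = card J'"
    using I J' finJ by (simp add: Int_absorb1)
  then have "(\<Sum>i\<in>I. c i) = n"
    using J' le by (simp add: c_def sum.distrib)
  moreover have "\<bar>x i - real (c i)\<bar> < 1" if "i \<in> I" for i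
    using b[OF that] J' by (auto simp: c_def J_def abs_less_iff)
  ultimately show ?thesis by blast
qed

lemma map_with_fiber_sizes_exists:
  assumes "finite I" "finite V" "(\<Sum>i\<in>I. c i) = card V"
  shows "\<exists>f\<in>V \<rightarrow> I. \<forall>i\<in>I. card {v \<in> V. f v = i} = c i"
  using assms
proof (induction I arbitrary: V rule: finite_induct)
  case empty
  then show ?case by simp
next
  case (insert a I)
  then have "c a \<le> card V" by simp
  then obtain W where W: "W \<subseteq> V" "card W = c a" "finite W"
    using obtain_subset_with_card_n by metis
  have "finite (V - W)" "(\<Sum>i\<in>I. c i) = card (V - W)"
    using insert W by (simp_all add: card_Diff_subset)
  from insert.IH[OF this] obtain f where f: "f \<in> V - W \<rightarrow> I"
    "\<And>i. i \<in> I \<Longrightarrow> card {v \<in> V - W. f v = i} = c i" by blast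
  define g where "g v = (if v \<in> W then a else f v)" for v
  have "g \<in> V \<rightarrow> insert a I" using funcset_mem[OF f(1)] by (auto simp: g_def)
  moreover have "card {v \<in> V. g v = i} = c i" if "i \<in> insert a I" for i
  proof (cases "i = a")
    case True
    have "{v \<in> V. g v = a} = W" using W(1) funcset_mem[OF f(1)] insert.hyps(2) by (auto simp: g_def)
    then show ?thesis using True W by simp
  next
    case False
    then have "{v \<in> V. g v = i} = {v \<in> V - W. f v = i}" by (auto simp: g_def)
    then show ?thesis using False f(2) that by simp
  qed
  ultimately show ?case by blast
qed

lemma clusters_exist:
  assumes "finite V" "\<alpha> \<in> feas q \<gamma>"
  shows "\<exists>C. clusters q \<alpha> V C"
proof -
  have "(\<Sum>A\<in>color_sets q. real (card V) * \<alpha> A) = real (card V)"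
    using assms(2) by (simp add: feas_def vtotal_def flip: sum_distrib_left)
  moreover have "0 \<le> real (card V) * \<alpha> A" if "A \<in> color_sets q" for A
    using assms(2) that by (simp add: feas_def)
  ultimately obtain c :: "nat set \<Rightarrow> nat" where c: "(\<Sum>A\<in>color_sets q. c A) = card V"
    "\<forall>A\<in>color_sets q. \<bar>real (card V) * \<alpha> A - real (c A)\<bar> < 1"
    using rounding_exists[OF finite_color_sets, of q "\<lambda>A. real (card V) * \<alpha> A" "card V"] by blast
  obtain f where f: "f \<in> V \<rightarrow> color_sets q" "\<forall>A\<in>color_sets q. card {v \<in> V. f v = A} = c A"
    using map_with_fiber_sizes_exists[OF finite_color_sets assms(1) c(1)] by blast
  have "clusters q \<alpha> V (\<lambda>A. {v \<in> V. f v = A})"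
    unfolding clusters_def using f c(2) by (auto simp: disjoint_family_on_def)
  then show ?thesis by blast
qed

lemma card_complete_bipartite:
  assumes "finite U1" "finite U2" "U1 \<inter> U2 = {}"
  shows "card {{u, v} | u v. u \<in> U1 \<and> v \<in> U2} = card U1 * card U2"
proof -
  have "{{u, v} | u v. u \<in> U1 \<and> v \<in> U2} = (\<lambda>(u, v). {u, v}) ` (U1 \<times> U2)" by auto
  moreover have "inj_on (\<lambda>(u, v). {u, v}) (U1 \<times> U2)"
    using assms(3) by (auto simp: inj_on_def doubleton_eq_iff)
  ultimately show ?thesis by (simp add: card_image card_cartesian_product)
qed

text \<open>This is why two sides of \<open>?s\<close> vertices have room for \<open>k\<close>
  edges.\<close>

lemma le_ceiling_sqrt_square: "k \<le> nat \<lceil>sqrt (real k)\<rceil> * nat \<lceil>sqrt (real k)\<rceil>" (is "_ \<le> ?s * ?s")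
proof -
  have "sqrt (real k) \<le> real ?s" by (rule real_nat_ceiling_ge)
  then have "sqrt (real k) * sqrt (real k) \<le> real ?s * real ?s"
    by (intro mult_mono) (simp_all only: real_sqrt_ge_zero of_nat_0_le_iff)
  then have "real k \<le> real (?s * ?s)" by simp
  then show ?thesis by (simp only: of_nat_le_iff)
qed

text \<open>Existence ensures that the claim about all outcomes of Construction 2 is not vacuous.
  Each choice can be made: cluster sizes by rounding, a largest cluster because
  \<open>q \<ge> 2\<close>, and then either the extra edges or a transferred Turan graph.\<close>

lemma construction2_exists:
  assumes q: "q \<ge> 2" and V: "finite V" and \<alpha>: "\<alpha> \<in> feas q \<gamma>" and T: "turan_graph q W T" "card W = card V"
  shows "\<exists>E. construction2 q \<alpha> m V E"
proof -
  obtain C where C: "clusters q \<alpha> V C" using clusters_exist[OF V \<alpha>] by blast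
  define E where "E = cluster_edges q C"
  have c1: "construction1 q \<alpha> V C E" using V C by (simp add: construction1_def E_def)
  show ?thesis
  proof (cases "card E \<ge> m")
    case True
    then show ?thesis unfolding construction2_def using c1 by (intro exI[of _ E] exI[of _ C]) simp
  next
    case False
    let ?I = "{A \<in> color_sets q. card A \<ge> 2}"
    \<comment> \<open>This makes the family of candidate clusters nonempty, so the maximum below
      exists.\<close>
    have "{1, 2} \<in> ?I" using q by (auto simp: color_sets_def)
    then have "Max ((card \<circ> C) ` ?I) \<in> (card \<circ> C) ` ?I" by (intro Max_in) auto
    then obtain A where A: "A \<in> ?I" "card (C A) = Max ((card \<circ> C) ` ?I)" by auto
    have "card (C B) \<le> card (C A)" if "B \<in> ?I" for B
      using that unfolding A(2) by (intro Max_ge) auto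
    then have lA: "largest_cluster q C A" using A by (simp add: largest_cluster_def)
    define k where "k = m - card E"
    define s where "s = nat \<lceil>sqrt (real k)\<rceil>"
    have finCA: "finite (C A)" using C V A by (auto simp: clusters_def intro: finite_subset)
    have "\<exists>E'. if card (C A) \<ge> 2 * s
             then (\<exists>U1 U2 F. U1 \<subseteq> C A \<and> U2 \<subseteq> C A \<and> U1 \<inter> U2 = {} \<and> card U1 = s \<and> card U2 = s \<and>
                     F \<subseteq> {{u, v} | u v. u \<in> U1 \<and> v \<in> U2} \<and> card F = k \<and> E' = E \<union> F)
             else turan_graph q V E'"
    proof (cases "card (C A) \<ge> 2 * s")
      case True
      then obtain U1 where U1: "U1 \<subseteq> C A" "card U1 = s" "finite U1"
        using obtain_subset_with_card_n[of s "C A"] by auto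
      have "card (C A - U1) \<ge> s" using True U1 by (simp add: card_Diff_subset)
      then obtain U2 where U2: "U2 \<subseteq> C A - U1" "card U2 = s" "finite U2"
        using obtain_subset_with_card_n[of s "C A - U1"] by auto
      have "k \<le> card {{u, v} | u v. u \<in> U1 \<and> v \<in> U2}"
      proof -
        have "U1 \<inter> U2 = {}" using U2 by blast
        then show ?thesis
          using card_complete_bipartite[of U1 U2] U1 U2 le_ceiling_sqrt_square[of k] by (simp add: s_def)
      qed
      then obtain F where F: "F \<subseteq> {{u, v} | u v. u \<in> U1 \<and> v \<in> U2}" "card F = k"
        by (rule obtain_subset_with_card_n)
      have "U2 \<subseteq> C A" "U1 \<inter> U2 = {}" using U2(1) by auto
      then show ?thesis
        unfolding if_P[OF True] using U1(1,2) U2(2) F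
        by (intro exI[of _ "E \<union> F"] exI[of _ U1] exI[of _ U2] exI[of _ F] conjI refl)
    next
      case False
      then show ?thesis using turan_graph_transfer[OF T(1) V] T(2) by simp
    qed
    then obtain E' where E': "if card (C A) \<ge> 2 * s
             then (\<exists>U1 U2 F. U1 \<subseteq> C A \<and> U2 \<subseteq> C A \<and> U1 \<inter> U2 = {} \<and> card U1 = s \<and> card U2 = s \<and>
                     F \<subseteq> {{u, v} | u v. u \<in> U1 \<and> v \<in> U2} \<and> card F = k \<and> E' = E \<union> F)
             else turan_graph q V E'" ..
    show ?thesis
      unfolding construction2_def Let_def
      by (intro exI[of _ E'] exI[of _ C] exI[of _ E] conjI c1)
        (unfold if_not_P[OF False], intro exI[of _ A] conjI lA E'[unfolded k_def s_def])
  qed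
qed


section \<open>Colorings of the constructed graphs\<close>

text \<open>Sending each vertex to the index of its cluster encodes the partition as a vertex map,
  so that Construction 1 produces \<open>disjoint_edges\<close>.\<close>

lemma clusters_function:
  assumes "clusters q \<alpha> V C"
  obtains f where "f \<in> V \<rightarrow> color_sets q" "\<And>A. A \<in> color_sets q \<Longrightarrow> C A = {v \<in> V. f v = A}"
    "cluster_edges q C = disjoint_edges V f"
proof -
  have UN: "(\<Union>A\<in>color_sets q. C A) = V" and dis: "disjoint_family_on C (color_sets q)"
    using assms by (auto simp: clusters_def)
  have "\<forall>v\<in>V. \<exists>A\<in>color_sets q. v \<in> C A" using UN by blast
  then obtain f where f: "\<And>v. v \<in> V \<Longrightarrow> f v \<in> color_sets q \<and> v \<in> C (f v)" by metis
  have C: "C A = {v \<in> V. f v = A}" if "A \<in> color_sets q" for A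
  proof -
    have "f v = A" if "v \<in> C A" "v \<in> V" for v
      using f[OF that(2)] that(1) dis \<open>A \<in> color_sets q\<close> by (auto simp: disjoint_family_on_def)
    then show ?thesis using f that UN by auto
  qed
  have "cluster_edges q C = disjoint_edges V f"
  proof (intro subset_antisym subsetI)
    fix e assume "e \<in> cluster_edges q C"
    then obtain u v A B where "e = {u, v}" "A \<in> color_sets q" "B \<in> color_sets q" "A \<inter> B = {}" "u \<in> C A" "v \<in> C B"
      unfolding cluster_edges_def by blast
    then show "e \<in> disjoint_edges V f"
      unfolding disjoint_edges_def using C by blast
  next
    fix e assume "e \<in> disjoint_edges V f"
    then obtain u v where "e = {u, v}" "u \<in> V" "v \<in> V" "f u \<inter> f v = {}"
      by (auto simp: disjoint_edges_def)
    then show "e \<in> cluster_edges q C"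
      unfolding cluster_edges_def using f[of u] f[of v] by blast
  qed
  then show thesis using that[of f] f C by blast
qed

text \<open>Rounding moves each cluster size by less than 1, so each product of two sizes drops by
  at most \<open>2 * n\<close>. Summing over at most \<open>(card (color_sets q))^2\<close> ordered
  pairs counts every lost edge twice.\<close>

lemma missing_edges_le:
  assumes V: "finite V" "V \<noteq> {}" and \<alpha>: "\<alpha> \<in> feas q \<gamma>" and f: "f \<in> V \<rightarrow> color_sets q"
    and close: "\<And>A. A \<in> color_sets q \<Longrightarrow> \<bar>real (card V) * \<alpha> A - real (card {v \<in> V. f v = A})\<bar> < 1"
  shows "(real (card V))\<^sup>2 * \<gamma> - real (card (disjoint_edges V f))
    \<le> (real (card (color_sets q)))\<^sup>2 * real (card V)"
proof -
  define n where "n = real (card V)"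
  have n: "n > 0" using V by (simp add: n_def card_gt_0_iff)
  define c where "c A = n * weight V f A" for A
  have c: "c A = real (card {v \<in> V. f v = A})" for A using n by (simp add: c_def weight_def n_def)
  have c_le: "c A \<le> n" for A unfolding c n_def using V by (auto intro: card_mono)
  have pair: "(n * \<alpha> A) * (n * \<alpha> B) - c A * c B \<le> 2 * n" if "A \<in> color_sets q" "B \<in> color_sets q" for A B
  proof -
    have x: "0 \<le> \<alpha> A" "\<alpha> A \<le> 1" using \<alpha> feas_le_one[OF \<alpha>] that by (auto simp: feas_def)
    \<comment> \<open>Replace one factor at a time.\<close>
    have "(n * \<alpha> A) * (n * \<alpha> B) - c A * c B = n * (\<alpha> A * (n * \<alpha> B - c B)) + c B * (n * \<alpha> A - c A)"
      by (simp add: algebra_simps)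
    also have "\<dots> \<le> n * (1 * 1) + n * 1"
    proof (intro add_mono mult_left_mono)
      have "\<alpha> A * (n * \<alpha> B - c B) \<le> \<alpha> A * 1"
        using x close[OF that(2)] unfolding c n_def by (intro mult_left_mono) auto
      then show "\<alpha> A * (n * \<alpha> B - c B) \<le> 1 * 1" using x by simp
      have "c B * (n * \<alpha> A - c A) \<le> c B * 1"
        using close[OF that(1)] unfolding c n_def by (intro mult_left_mono) auto
      then show "c B * (n * \<alpha> A - c A) \<le> n * 1" using c_le[of B] by simp
    qed (use n in auto)
    finally show ?thesis by simp
  qed
  have scale: "2 * (n\<^sup>2 * etotal q x) = (\<Sum>(A, B)\<in>disjoint_color_pairs q. (n * x A) * (n * x B))" for x
  proof -
    have "2 * (n\<^sup>2 * etotal q x) = n\<^sup>2 * (\<Sum>(A, B)\<in>disjoint_color_pairs q. x A * x B)"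
      by (simp flip: etotal_ordered)
    also have "\<dots> = (\<Sum>(A, B)\<in>disjoint_color_pairs q. (n * x A) * (n * x B))"
      unfolding sum_distrib_left by (intro sum.cong) (auto simp: power2_eq_square)
    finally show ?thesis .
  qed
  have "2 * (n\<^sup>2 * \<gamma> - real (card (disjoint_edges V f))) \<le> 2 * (n\<^sup>2 * etotal q \<alpha>) - 2 * (n\<^sup>2 * etotal q (weight V f))"
    using \<alpha> card_disjoint_edges[OF V f] by (simp add: feas_def n_def mult_left_mono)
  also have "\<dots> = (\<Sum>(A, B)\<in>disjoint_color_pairs q. (n * \<alpha> A) * (n * \<alpha> B) - c A * c B)"
    unfolding scale c_def by (simp add: sum_subtractf case_prod_unfold)
  also have "\<dots> \<le> (\<Sum>(A, B)\<in>disjoint_color_pairs q. 2 * n)"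
    by (intro sum_mono) (auto simp: disjoint_color_pairs_def pair)
  also have "\<dots> = real (card (disjoint_color_pairs q)) * (2 * n)" by (simp add: case_prod_unfold)
  also have "\<dots> \<le> (real (card (color_sets q)))\<^sup>2 * (2 * n)"
  proof (intro mult_right_mono)
    have "card (disjoint_color_pairs q) \<le> card (color_sets q \<times> color_sets q)"
      by (intro card_mono disjoint_color_pairs_subset) simp
    then have "real (card (disjoint_color_pairs q)) \<le> real (card (color_sets q \<times> color_sets q))"
      by (simp only: of_nat_le_iff)
    then show "real (card (disjoint_color_pairs q)) \<le> (real (card (color_sets q)))\<^sup>2"
      by (simp add: card_cartesian_product power2_eq_square)
  qed (use n in auto)
  finally show ?thesis by (simp add: n_def)
qed

text \<open>The hypothesis \<open>large\<close> is a common budget for three cases. Unrepaired, the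
  logarithm of the count loses at most \<open>N * L\<close> to rounding; the repair costs a further
  \<open>O(sqrt n)\<close>; and in the Turan case the optimum itself is within the budget.\<close>

lemma construction2_properties:
  assumes q: "q \<ge> 2" and V: "finite V" "V \<noteq> {}"
    and sol: "solves_opt q (real m / (real (card V))\<^sup>2) \<alpha>"
    and T: "turan_graph q W T" "card W = card V" "m \<le> card T"
    and con: "construction2 q \<alpha> m V E'"
    and large: "real (card (color_sets q)) * ln (real q)
      * (2 * real (card (color_sets q)) * sqrt (real (card V)) + 3) < \<epsilon> * real (card V)"
  shows "simple_graph V E'" and "m \<le> card E'"
    and "exp ((opt q (real m / (real (card V))\<^sup>2) - \<epsilon>) * real (card V)) < real (card (proper_colorings q V E'))"
proof -
  define n where "n = real (card V)"
  define N where "N = real (card (color_sets q))"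
  define L where "L = ln (real q)"
  define target where "target = (opt q (real m / n\<^sup>2) - \<epsilon>) * n"
  have n: "n > 0" using V by (simp add: n_def card_gt_0_iff)
  have L: "L > 0" using q by (simp add: L_def)
  have "{1} \<in> color_sets q" using q by (auto simp: color_sets_def)
  then have "card (color_sets q) \<ge> 1" by (simp add: Suc_le_eq card_gt_0_iff) blast
  then have N: "N \<ge> 1" by (simp add: N_def)
  have large: "N * L * (2 * N * sqrt n + 3) < \<epsilon> * n"
    using large by (simp add: N_def L_def n_def)
  have \<alpha>: "\<alpha> \<in> feas q (real m / n\<^sup>2)" and obj: "obj q \<alpha> = opt q (real m / n\<^sup>2)"
    using sol by (auto simp: solves_opt_def n_def)
  obtain C E where cl: "clusters q \<alpha> V C" and E: "E = cluster_edges q C"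
    and cases: "if card E \<ge> m then E' = E
         else (\<exists>A. largest_cluster q C A \<and>
           (let k = m - card E; s = nat \<lceil>sqrt (real k)\<rceil> in
             if card (C A) \<ge> 2 * s
             then (\<exists>U1 U2 F. U1 \<subseteq> C A \<and> U2 \<subseteq> C A \<and> U1 \<inter> U2 = {} \<and> card U1 = s \<and> card U2 = s \<and>
                     F \<subseteq> {{u, v} | u v. u \<in> U1 \<and> v \<in> U2} \<and> card F = k \<and> E' = E \<union> F)
             else turan_graph q V E'))"
    using con unfolding construction2_def construction1_def by blast
  obtain f where f: "f \<in> V \<rightarrow> color_sets q" and C: "\<And>A. A \<in> color_sets q \<Longrightarrow> C A = {v \<in> V. f v = A}"
    and Ef: "E = disjoint_edges V f"
    using clusters_function[OF cl] E by metis
  have close: "\<bar>n * \<alpha> A - real (card {v \<in> V. f v = A})\<bar> < 1" if "A \<in> color_sets q" for A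
  proof -
    have "\<bar>n * \<alpha> A - real (card (C A))\<bar> < 1" using cl that by (auto simp: clusters_def n_def)
    then show ?thesis unfolding C[OF that] .
  qed
  have simpleE: "simple_graph V E" unfolding Ef by (rule simple_graph_disjoint_edges[OF V(1) f])
  have finE: "finite E" by (rule finite_simple_graph_edges[OF simpleE])
  have edge_f: "f u \<inter> f v = {}" if "{u, v} \<in> E" for u v
    using that unfolding Ef disjoint_edges_def by (auto simp: doubleton_eq_iff)
  have "n * obj q \<alpha> - N * L \<le> (\<Sum>A\<in>color_sets q. real (card {v \<in> V. f v = A}) * ln (real (card A)))"
  proof -
    have "n * obj q \<alpha> - N * L = (\<Sum>A\<in>color_sets q. n * \<alpha> A * ln (real (card A)) - L)"
      by (simp add: obj_def N_def sum_subtractf sum_distrib_left mult.assoc)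
    also have "\<dots> \<le> (\<Sum>A\<in>color_sets q. real (card {v \<in> V. f v = A}) * ln (real (card A)))"
    proof (rule sum_mono)
      fix A assume A: "A \<in> color_sets q"
      have "(n * \<alpha> A - real (card {v \<in> V. f v = A})) * ln (real (card A)) \<le> 1 * ln (real (card A))"
        using close[OF A] ln_card_bounds[OF A] by (intro mult_right_mono) auto
      then show "n * \<alpha> A * ln (real (card A)) - L \<le> real (card {v \<in> V. f v = A}) * ln (real (card A))"
        using ln_card_bounds[OF A] by (simp add: L_def algebra_simps)
    qed
    finally show ?thesis .
  qed
  then have ln_f: "n * obj q \<alpha> - N * L \<le> (\<Sum>v\<in>V. ln (real (card (f v))))"
    unfolding sum_over_fibers[OF V(1) f] .
  have target: "target = n * obj q \<alpha> - \<epsilon> * n" by (simp add: target_def obj algebra_simps)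
  have NL: "N * L * (2 * N * sqrt n + 3) = 2 * (N * L) * (N * sqrt n) + 3 * (N * L)"
    by (simp add: algebra_simps)
  have nonneg: "0 \<le> (N * L) * (N * sqrt n)" "0 < N * L" "L \<le> N * L" using N L n by simp_all
  have "simple_graph V E' \<and> m \<le> card E' \<and> exp target < real (card (proper_colorings q V E'))"
  proof (cases "card E \<ge> m")
    case True
    then have E': "E' = E" using cases by simp
    have "target < (\<Sum>v\<in>V. ln (real (card (f v))))"
      using ln_f large NL nonneg unfolding target by linarith
    then have "exp target < exp (\<Sum>v\<in>V. ln (real (card (f v))))" by simp
    also have "\<dots> \<le> real (card (proper_colorings q V E))"
      by (rule proper_colorings_ge[OF V(1) f simpleE edge_f])
    finally show ?thesis using True simpleE E' by simp
  next
    case False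
    define k where "k = m - card E"
    define s where "s = nat \<lceil>sqrt (real k)\<rceil>"
    obtain A where A: "largest_cluster q C A"
      and A_cases: "if card (C A) \<ge> 2 * s
             then (\<exists>U1 U2 F. U1 \<subseteq> C A \<and> U2 \<subseteq> C A \<and> U1 \<inter> U2 = {} \<and> card U1 = s \<and> card U2 = s \<and>
                     F \<subseteq> {{u, v} | u v. u \<in> U1 \<and> v \<in> U2} \<and> card F = k \<and> E' = E \<union> F)
             else turan_graph q V E'"
      using cases False unfolding Let_def k_def s_def by auto
    have Acs: "A \<in> color_sets q" and A2: "card A \<ge> 2"
      and Amax: "\<And>B. B \<in> color_sets q \<Longrightarrow> card B \<ge> 2 \<Longrightarrow> card (C B) \<le> card (C A)"
      using A by (auto simp: largest_cluster_def)
    \<comment> \<open>Only linearly many edges are missing, so \<open>s\<close> is of order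
      \<open>sqrt n\<close>; the extra 1 below comes from the ceiling.\<close>
    have "real k = n\<^sup>2 * (real m / n\<^sup>2) - real (card (disjoint_edges V f))"
      using False n by (simp add: k_def Ef of_nat_diff)
    also have "\<dots> \<le> N\<^sup>2 * n"
      unfolding n_def N_def
      by (rule missing_edges_le[OF V \<alpha>[unfolded n_def] f close[unfolded n_def]])
    finally have "sqrt (real k) \<le> sqrt (N\<^sup>2 * n)" by (rule real_sqrt_le_mono)
    also have "\<dots> = N * sqrt n" using N by (simp add: real_sqrt_mult)
    finally have "sqrt (real k) \<le> N * sqrt n" .
    moreover have "0 \<le> sqrt (real k)" by simp
    ultimately have s: "real s \<le> N * sqrt n + 1" unfolding s_def by linarith
    show ?thesis
    proof (cases "card (C A) \<ge> 2 * s")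
      case True
      then obtain U1 U2 F where U: "U1 \<subseteq> C A" "U2 \<subseteq> C A" "U1 \<inter> U2 = {}" "card U1 = s" "card U2 = s"
        and F: "F \<subseteq> {{u, v} | u v. u \<in> U1 \<and> v \<in> U2}" "card F = k" and E': "E' = E \<union> F"
        using A_cases by auto
      have UA: "v \<in> V \<and> f v = A" if "v \<in> U1 \<union> U2" for v
        using that U C[OF Acs] by auto
      have finU: "finite U1" "finite U2" using V(1) UA by (auto intro: finite_subset)
      have "F \<subseteq> (\<lambda>(u, v). {u, v}) ` (U1 \<times> U2)" using F(1) by auto
      then have finF: "finite F" using finU by (auto intro: finite_subset)
      have simpleF: "simple_graph V F"
        unfolding simple_graph_def
      proof (intro conjI V(1) subsetI)
        fix e assume "e \<in> F"
        then obtain u v where "e = {u, v}" "u \<in> U1" "v \<in> U2" using F(1) by blast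
        then show "e \<in> {{u, v} | u v. u \<in> V \<and> v \<in> V \<and> u \<noteq> v}" using U(3) UA by blast
      qed
      have simpleE': "simple_graph V E'"
        using simpleE simpleF unfolding E' simple_graph_def by blast
      \<comment> \<open>Added edges lie inside cluster \<open>A\<close>, and the nonempty
        \<open>A\<close> is not disjoint from itself, so none of them was present before.\<close>
      have "E \<inter> F = {}"
      proof (rule ccontr)
        assume "E \<inter> F \<noteq> {}"
        then obtain u v where "{u, v} \<in> E" "u \<in> U1" "v \<in> U2" using F(1) by blast
        then have "A \<inter> A = {}" using edge_f[of u v] UA by auto
        then show False using A2 by simp
      qed
      then have "card E' = card E + k" using card_Un_disjoint[OF finE finF] F(2) E' by simp
      then have "m \<le> card E'" using False by (simp add: k_def)
      obtain D where "D \<subseteq> A" "card D = 2" using obtain_subset_with_card_n[OF A2] by blast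
      then obtain i j where ij: "i \<in> A" "j \<in> A" "i \<noteq> j" by (auto simp: card_2_iff)
      \<comment> \<open>Fixing color \<open>i\<close> on \<open>U1\<close> and \<open>j\<close> on
        \<open>U2\<close> satisfies all new edges. Every set only shrinks, so the old edges stay
        satisfied.\<close>
      define g where "g v = (if v \<in> U1 then {i} else if v \<in> U2 then {j} else f v)" for v
      have g_sub: "g v \<subseteq> f v" if "v \<in> V" for v
        using UA ij by (auto simp: g_def)
      have g: "g \<in> V \<rightarrow> color_sets q"
      proof
        fix v assume v: "v \<in> V"
        have "g v \<noteq> {}" using funcset_mem[OF f v] by (auto simp: g_def color_sets_def)
        then show "g v \<in> color_sets q"
          using funcset_mem[OF f v] g_sub[OF v] by (auto simp: color_sets_def)
      qed
      have edge_g: "g u \<inter> g v = {}" if "{u, v} \<in> E'" for u v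
      proof (cases "{u, v} \<in> E")
        case True
        moreover have "u \<in> V" "v \<in> V" using simpleE' that by (auto simp: simple_graph_def doubleton_eq_iff)
        ultimately show ?thesis using edge_f[OF True] g_sub by blast
      next
        case False
        then have "{u, v} \<in> {{u, v} | u v. u \<in> U1 \<and> v \<in> U2}" using that E' F(1) by (meson UnE subsetD)
        then have "u \<in> U1 \<and> v \<in> U2 \<or> v \<in> U1 \<and> u \<in> U2" by (auto simp: doubleton_eq_iff)
        then show ?thesis using U(3) ij by (auto simp: g_def doubleton_eq_iff)
      qed
      have "(\<Sum>v\<in>V. ln (real (card (f v)))) - (\<Sum>v\<in>V. ln (real (card (g v))))
          = (\<Sum>v\<in>V. ln (real (card (f v))) - ln (real (card (g v))))"
        by (simp add: sum_subtractf)
      \<comment> \<open>Only the \<open>2 * s\<close> repaired vertices lose freedom, each at most a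
        factor \<open>q\<close>.\<close>
      also have "\<dots> \<le> (\<Sum>v\<in>V. if v \<in> U1 \<union> U2 then L else 0)"
      proof (rule sum_mono)
        fix v assume v: "v \<in> V"
        have "ln (real (card (f v))) \<le> L" unfolding L_def by (rule ln_card_bounds(2)[OF funcset_mem[OF f v]])
        then show "ln (real (card (f v))) - ln (real (card (g v))) \<le> (if v \<in> U1 \<union> U2 then L else 0)"
          by (auto simp: g_def)
      qed
      also have "\<dots> = real (card (U1 \<union> U2)) * L"
      proof -
        have "V \<inter> (U1 \<union> U2) = U1 \<union> U2" using UA by blast
        then show ?thesis using V(1) sum.inter_restrict[OF V(1), of "\<lambda>_. L" "U1 \<union> U2"] by simp
      qed
      also have "\<dots> \<le> (2 * (N * sqrt n + 1)) * L"
      proof (rule mult_right_mono)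
        have "card (U1 \<union> U2) \<le> 2 * s" using card_Un_le[of U1 U2] U by simp
        then have "real (card (U1 \<union> U2)) \<le> 2 * real s" by linarith
        then show "real (card (U1 \<union> U2)) \<le> 2 * (N * sqrt n + 1)"
          by (rule order_trans) (use s in \<open>intro mult_left_mono, simp_all\<close>)
      qed (use L in simp)
      also have "\<dots> \<le> 2 * (N * L) * (N * sqrt n) + 2 * (N * L)"
      proof -
        have "L * (N * sqrt n) \<le> (N * L) * (N * sqrt n)" using nonneg(3) N n by (intro mult_right_mono) auto
        then show ?thesis using nonneg(3) by (simp add: algebra_simps)
      qed
      finally have "target < (\<Sum>v\<in>V. ln (real (card (g v))))"
        using ln_f large NL nonneg unfolding target by linarith
      then have "exp target < exp (\<Sum>v\<in>V. ln (real (card (g v))))" by simp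
      also have "\<dots> \<le> real (card (proper_colorings q V E'))"
        by (rule proper_colorings_ge[OF V(1) g simpleE' edge_g])
      finally show ?thesis using simpleE' \<open>m \<le> card E'\<close> by simp
    next
      case False
      then have E': "turan_graph q V E'" using A_cases by simp
      obtain part where "part \<in> V \<rightarrow> {1..q}" and E'p: "E' = disjoint_edges V (\<lambda>v. {part v})"
        and p: "(\<lambda>v. {part v}) \<in> V \<rightarrow> color_sets q"
        using turan_graph_disjoint_edges[OF E'] by blast
      have "simple_graph V E'" unfolding E'p by (rule simple_graph_disjoint_edges[OF V(1) p])
      \<comment> \<open>The number of edges of a Turan graph depends only on \<open>q\<close> and
        the number of vertices.\<close>
      have "2 * int (card E') = 2 * int (card T)"
        unfolding turan_graph_card[OF E'] turan_graph_card[OF T(1)] T(2) ..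
      then have "m \<le> card E'" using T(3) by simp
      \<comment> \<open>Clusters with at least two colors have fewer than \<open>2 * s\<close>
        vertices, so \<open>n * \<alpha> B\<close> is at most \<open>2 * s + 1\<close>, whence the
        constant 3; singletons contribute nothing. The target exponent is then negative, and one
        coloring is enough.\<close>
      have "n * obj q \<alpha> = (\<Sum>B\<in>color_sets q. n * \<alpha> B * ln (real (card B)))"
        by (simp add: obj_def sum_distrib_left mult.assoc)
      also have "\<dots> \<le> (\<Sum>B\<in>color_sets q. (2 * (N * sqrt n) + 3) * L)"
      proof (rule sum_mono)
        fix B assume B: "B \<in> color_sets q"
        have pos: "0 \<le> 2 * (N * sqrt n) + 3" using N n by simp
        show "n * \<alpha> B * ln (real (card B)) \<le> (2 * (N * sqrt n) + 3) * L"
        proof (cases "card B \<ge> 2")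
          case True
          have "card {v \<in> V. f v = B} < 2 * s" using Amax[OF B True] False C[OF B] by simp
          then have "real (card {v \<in> V. f v = B}) \<le> 2 * real s" by linarith
          then have "n * \<alpha> B \<le> 2 * (N * sqrt n) + 3" using close[OF B] s by linarith
          then show ?thesis
            using ln_card_bounds[OF B] pos by (intro mult_mono) (auto simp: L_def)
        next
          case False
          then have "card B = 1" using color_sets_card_pos[OF B] by simp
          then show ?thesis using pos L by simp
        qed
      qed
      also have "\<dots> = N * L * (2 * N * sqrt n + 3)" by (simp add: N_def algebra_simps)
      finally have "target < 0" using large unfolding target by linarith
      then have "exp target < 1" by simp
      also have "1 = exp (\<Sum>v\<in>V. ln (real (card {part v})))" by simp
      also have "\<dots> \<le> real (card (proper_colorings q V E'))"
      proof (rule proper_colorings_ge[OF V(1) p \<open>simple_graph V E'\<close>])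
        fix u v assume "{u, v} \<in> E'"
        then show "{part u} \<inter> {part v} = {}"
          unfolding E'p disjoint_edges_def by (auto simp: doubleton_eq_iff)
      qed
      finally show ?thesis using \<open>simple_graph V E'\<close> \<open>m \<le> card E'\<close> by simp
    qed
  qed
  then show "simple_graph V E'" "m \<le> card E'"
    "exp ((opt q (real m / (real (card V))\<^sup>2) - \<epsilon>) * real (card V)) < real (card (proper_colorings q V E'))"
    by (simp_all add: target_def n_def)
qed

section \<open>Choice of the threshold and combination of both bounds\<close>

theorem theorem3p2:
  fixes q :: nat and \<epsilon> :: real
  assumes "q \<ge> 2" and "\<epsilon> > 0"
  shows "\<exists>n0. \<forall>n\<ge>n0. \<forall>m (T :: nat set set). turan_graph q {..<n} T \<and> m \<le> card T \<longrightarrow>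
    (\<forall>(V :: nat set) E. simple_graph V E \<and> card V = n \<and> card E = m \<longrightarrow>
       real (card (proper_colorings q V E))
         < exp ((opt q (real m / (real n)\<^sup>2) + \<epsilon>) * real n)) \<and>
    (\<forall>\<alpha> (V :: nat set). solves_opt q (real m / (real n)\<^sup>2) \<alpha> \<and> finite V \<and> card V = n \<longrightarrow>
       (\<exists>E. construction2 q \<alpha> m V E) \<and>
       (\<forall>E. construction2 q \<alpha> m V E \<longrightarrow>
          simple_graph V E \<and> card E \<ge> m \<and>
          real (card (proper_colorings q V E))
            > exp ((opt q (real m / (real n)\<^sup>2) - \<epsilon>) * real n)))"
proof -
  obtain \<eta> where \<eta>: "\<eta> > 0" and robust:
    "\<And>\<gamma> \<alpha>. feas q \<gamma> \<noteq> {} \<Longrightarrow> \<alpha> \<in> feas q (\<gamma> - \<eta>) \<Longrightarrow> obj q \<alpha> \<le> opt q \<gamma> + \<epsilon> / 2"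
    using opt_robust[OF assms(1), of "\<epsilon> / 2"] assms(2) by auto
  \<comment> \<open>This choice makes the edge loss \<open>q * \<delta> / 2\<close> of the
    containers equal to the slack \<open>\<eta>\<close> that the optimum tolerates.\<close>
  define \<delta> where "\<delta> = 2 * \<eta> / real q"
  have \<delta>: "\<delta> > 0" "real q * \<delta> / 2 = \<eta>" using \<eta> assms(1) by (auto simp: \<delta>_def)
  define k where "k = nat \<lfloor>1 / \<delta>\<rfloor> * q"
  define N where "N = real (card (color_sets q))"
  define L where "L = ln (real q)"
  have "(\<lambda>n. N * L * (2 * N * sqrt (real n) + 3) / real n) \<longlonglongrightarrow> 0"
    by real_asymp
  then have "\<forall>\<^sub>F n in sequentially. N * L * (2 * N * sqrt (real n) + 3) / real n < \<epsilon>"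
    using assms(2) by (rule order_tendstoD)
  moreover have "\<forall>\<^sub>F n in sequentially. real (n + 1) ^ k < exp (\<epsilon> / 2 * real n)"
    using assms(2) by (intro polynomial_below_exp) simp
  ultimately have "\<forall>\<^sub>F n in sequentially. n > 0 \<and> real (n + 1) ^ k < exp (\<epsilon> / 2 * real n)
      \<and> N * L * (2 * N * sqrt (real n) + 3) < \<epsilon> * real n"
    using eventually_gt_at_top[of 0] by eventually_elim (simp add: field_simps)
  then obtain n0 where n0: "\<And>n. n \<ge> n0 \<Longrightarrow> n > 0 \<and> real (n + 1) ^ k < exp (\<epsilon> / 2 * real n)
      \<and> N * L * (2 * N * sqrt (real n) + 3) < \<epsilon> * real n"
    unfolding eventually_sequentially by blast
  show ?thesis
  proof (intro exI[of _ n0] allI impI conjI; elim conjE)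
    fix n m :: nat and T :: "nat set set" and V :: "nat set" and E
    assume n: "n0 \<le> n" and T: "turan_graph q {..<n} T" "m \<le> card T"
      and G: "simple_graph V E" "card V = n" "card E = m"
    have "V \<noteq> {}" using G n0[OF n] by auto
    have "feas q (real m / (real n)\<^sup>2) \<noteq> {}"
      using turan_graph_feas[OF T(1) _ T(2)] n0[OF n] by (auto simp: lessThan_empty_iff)
    then have "real (card (proper_colorings q V E))
        \<le> real (card V + 1) ^ k * exp (real (card V) * (opt q (real m / (real n)\<^sup>2) + \<epsilon> / 2))"
      unfolding k_def using robust G \<delta> by (intro colorings_le[OF G(1) \<open>V \<noteq> {}\<close>]) auto
    \<comment> \<open>Half of \<open>\<epsilon>\<close> absorbs the number of fingerprints; the
      other half was spent on relaxing the edge constraint.\<close>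
    also have "\<dots> < exp (\<epsilon> / 2 * real n) * exp (real n * (opt q (real m / (real n)\<^sup>2) + \<epsilon> / 2))"
      unfolding G(2) using n0[OF n] by (intro mult_strict_right_mono) auto
    also have "\<dots> = exp ((opt q (real m / (real n)\<^sup>2) + \<epsilon>) * real n)"
      by (simp add: exp_add[symmetric] algebra_simps)
    finally show "real (card (proper_colorings q V E)) < exp ((opt q (real m / (real n)\<^sup>2) + \<epsilon>) * real n)" .
  next
    fix n m :: nat and T :: "nat set set" and V :: "nat set" and \<alpha>
    assume T: "turan_graph q {..<n} T" and sol: "solves_opt q (real m / (real n)\<^sup>2) \<alpha>"
      and V: "finite V" "card V = n"
    show "\<exists>E. construction2 q \<alpha> m V E"
      using construction2_exists[OF assms(1) V(1) _ T] sol V(2) by (auto simp: solves_opt_def)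
  next
    fix n m :: nat and T :: "nat set set" and V :: "nat set" and \<alpha> E
    assume n: "n0 \<le> n" and T: "turan_graph q {..<n} T" "m \<le> card T"
      and sol: "solves_opt q (real m / (real n)\<^sup>2) \<alpha>" and V: "finite V" "card V = n"
      and con: "construction2 q \<alpha> m V E"
    have "V \<noteq> {}" using V n0[OF n] by auto
    note props = construction2_properties[OF assms(1) V(1) \<open>V \<noteq> {}\<close>, unfolded V(2),
        OF sol T(1) _ T(2) con]
    have large: "real (card (color_sets q)) * ln (real q) * (2 * real (card (color_sets q)) * sqrt (real n) + 3)
        < \<epsilon> * real n"
      using n0[OF n] by (simp add: N_def L_def)
    show "simple_graph V E" "m \<le> card E"
      "exp ((opt q (real m / (real n)\<^sup>2) - \<epsilon>) * real n) < real (card (proper_colorings q V E))"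
      using props large by simp_all
  qed
qed

end
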